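(* For any tree $T$ the following are equivalent: ($A_1$) $T$ is an $\mathcal{R}_{01,02}$-graph; ($A_2$) there is a labeling $S:V(T)\to\{A,B,C\}$ such that $(T,S)\in\mathscr{T}_{01,02}$; ($A_3$) there is a labeling $L:V(T)\to\{A,B,C\}$ such that $(T,L)\in\mathscr{T}'_{01,02}$.
   Context: A Roman dominating function (RDF) on a graph $G$ is a map $f:V(G)\to\{0,1,2\}$ such that every vertex $v$ with $f(v)=0$ has a neighbor $u$ with $f(u)=2$; its weight is $\sum_v f(v)$. $\gamma_R(G)$ is the minimum weight of an RDF; an RDF of that weight is a $\gamma_R$-function. For $X\subseteq\{0,1,2\}$, $V^X(G)$ is the set of vertices $v$ with $\{f(v): f\text{ a }\gamma_R\text{-function}\}=X$. $G$ is an $\mathcal{R}_{01,02}$-graph if $V(G)=V^{\{0,1\}}(G)\cup V^{\{0,2\}}(G)$ and both sets are nonempty. A labeling assigns each vertex a status in $\{A,B,C\}$; statuses are kept under all operations below. Labeled trees: $(H_2,I^2)$: path on 4 vertices, endpoints status $A$, inner vertices status $B$. $(H_3,I^3)$: two adjacent vertices of status $C$, each adjacent to two leaves of status $A$. $(F_1,J^1)$: path $a,x,a'$ with statuses $A,C,A$. A $\overline{K_2}$-corona is a graph in which every vertex is a leaf or a stem (neighbor of a leaf) and each stem is adjacent to exactly $2$ leaves; a labeled $\overline{K_2}$-corona has all leaves of status $A$ and all stems of status $C$. $O_5$: add to $(T',S')$ a disjoint copy of $(F_1,J^1)$ and an edge $ux$ with $u\in V(T')$ of status $C$ and $x$ the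 middle vertex of $F_1$. $O_6$: identify a vertex of $T'$ of status $A$ with a vertex of status $A$ of a disjoint copy of $(H_2,I^2)$ or $(H_3,I^3)$; the identified vertex has status $A$. $\mathscr{T}_{01,02}$ is the family of labeled trees obtainable by a sequence starting with a copy of $(H_2,I^2)$ or $(H_3,I^3)$ and applying $O_5$ or $O_6$ at each step. $O_7$: identify a vertex of $T'$ of status $A$ with a vertex of status $A$ of a disjoint copy of $(H_2,I^2)$; the identified vertex has status $A$. $O_8$: identify a vertex of $T'$ of status $A$ with a vertex of status $A$ of a disjoint labeled $\overline{K_2}$-corona tree; the identified vertex has status $A$. $\mathscr{T}'_{01,02}$ is the family of labeled trees obtainable by a sequence starting with $(H_2,I^2)$ or a labeled $\overline{K_2}$-corona tree and applying $O_7$ or $O_8$ at each step.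
   Formalization: The labeled corona trees used as starting trees and in O_8 are required to have at least two stems, excluding the path P_3 (statuses A, C, A): with it allowed, P_3 satisfies A_3 but, having the unique γ_R-function (0,2,0), fails A_1. *)

theory Defs
  imports Main
begin

record 'a graph =
  verts :: "'a set"
  edges :: "'a set set"

definition simple_graph :: "'a graph \<Rightarrow> bool" where
  "simple_graph G \<longleftrightarrow> finite (verts G) \<and> verts G \<noteq> {} \<and>
     (\<forall>e\<in>edges G. \<exists>u v. e = {u, v} \<and> u \<noteq> v \<and> u \<in> verts G \<and> v \<in> verts G)"

definition adj :: "'a graph \<Rightarrow> 'a \<Rightarrow> 'a \<Rightarrow> bool" where
  "adj G u v \<longleftrightarrow> {u, v} \<in> edges G"

definition connected_graph :: "'a graph \<Rightarrow> bool" where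
  "connected_graph G \<longleftrightarrow> (\<forall>u\<in>verts G. \<forall>v\<in>verts G. (adj G)\<^sup>*\<^sup>* u v)"

definition is_cycle :: "'a graph \<Rightarrow> 'a list \<Rightarrow> bool" where
  "is_cycle G p \<longleftrightarrow> length p \<ge> 3 \<and> distinct p \<and> set p \<subseteq> verts G \<and>
     successively (adj G) p \<and> adj G (last p) (hd p)"

definition tree :: "'a graph \<Rightarrow> bool" where
  "tree G \<longleftrightarrow> simple_graph G \<and> connected_graph G \<and> (\<nexists>p. is_cycle G p)"

definition leaf :: "'a graph \<Rightarrow> 'a \<Rightarrow> bool" where
  "leaf G v \<longleftrightarrow> v \<in> verts G \<and> card {u \<in> verts G. adj G v u} = 1"

definition stem :: "'a graph \<Rightarrow> 'a \<Rightarrow> bool" where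
  "stem G v \<longleftrightarrow> v \<in> verts G \<and> (\<exists>u. leaf G u \<and> adj G v u)"


section \<open>Roman domination\<close>

text \<open>A map from the vertex set is a total function whose values outside
  \<^term>\<open>verts G\<close> are irrelevant.\<close>

definition RDF :: "'a graph \<Rightarrow> ('a \<Rightarrow> nat) \<Rightarrow> bool" where
  "RDF G f \<longleftrightarrow> f ` verts G \<subseteq> {0, 1, 2} \<and>
     (\<forall>v\<in>verts G. f v = 0 \<longrightarrow> (\<exists>u\<in>verts G. adj G v u \<and> f u = 2))"

definition weight :: "'a graph \<Rightarrow> ('a \<Rightarrow> nat) \<Rightarrow> nat" where
  "weight G f = (\<Sum>v\<in>verts G. f v)"

definition gamma_R :: "'a graph \<Rightarrow> nat" where
  "gamma_R G = (LEAST w. \<exists>f. RDF G f \<and> weight G f = w)"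

definition gamma_R_function :: "'a graph \<Rightarrow> ('a \<Rightarrow> nat) \<Rightarrow> bool" where
  "gamma_R_function G f \<longleftrightarrow> RDF G f \<and> weight G f = gamma_R G"

definition VX :: "nat set \<Rightarrow> 'a graph \<Rightarrow> 'a set" where
  "VX X G = {v \<in> verts G. {f v | f. gamma_R_function G f} = X}"

definition R_01_02_graph :: "'a graph \<Rightarrow> bool" where
  "R_01_02_graph G \<longleftrightarrow> verts G = VX {0, 1} G \<union> VX {0, 2} G \<and>
     VX {0, 1} G \<noteq> {} \<and> VX {0, 2} G \<noteq> {}"


section \<open>Labeled trees\<close>

datatype status = StA | StB | StC

text \<open>A labeled tree is given by a graph and a total function to statuses, of which only the
  values on the vertex set matter. The predicates below hold for every copy of the named labeled
  tree inside the vertex type.\<close>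

definition is_H2 :: "'a graph \<Rightarrow> ('a \<Rightarrow> status) \<Rightarrow> bool" where
  "is_H2 G S \<longleftrightarrow> (\<exists>a b c d. distinct [a, b, c, d] \<and>
     verts G = {a, b, c, d} \<and> edges G = {{a, b}, {b, c}, {c, d}} \<and>
     S a = StA \<and> S b = StB \<and> S c = StB \<and> S d = StA)"

definition is_H3 :: "'a graph \<Rightarrow> ('a \<Rightarrow> status) \<Rightarrow> bool" where
  "is_H3 G S \<longleftrightarrow> (\<exists>x y a a' b b'. distinct [x, y, a, a', b, b'] \<and>
     verts G = {x, y, a, a', b, b'} \<and>
     edges G = {{x, y}, {x, a}, {x, a'}, {y, b}, {y, b'}} \<and>
     S x = StC \<and> S y = StC \<and> S a = StA \<and> S a' = StA \<and> S b = StA \<and> S b' = StA)"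

text \<open>The first argument is the middle vertex.\<close>

definition is_F1 :: "'a \<Rightarrow> 'a graph \<Rightarrow> ('a \<Rightarrow> status) \<Rightarrow> bool" where
  "is_F1 x G S \<longleftrightarrow> (\<exists>a a'. distinct [a, x, a'] \<and>
     verts G = {a, x, a'} \<and> edges G = {{a, x}, {x, a'}} \<and>
     S a = StA \<and> S x = StC \<and> S a' = StA)"

definition K2bar_corona :: "'a graph \<Rightarrow> bool" where
  "K2bar_corona G \<longleftrightarrow> simple_graph G \<and> (\<forall>v\<in>verts G. leaf G v \<or> stem G v) \<and>
     (\<forall>v. stem G v \<longrightarrow> card {u. leaf G u \<and> adj G v u} = 2)"

text \<open>The corona trees used as building blocks are required to have at least two stems. The path
  on three vertices (the corona of a single vertex) has to be excluded: it has a unique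
  minimum Roman dominating function, so it is not an \<open>R_01_02\<close>-graph, and neither is
  the path on six vertices, which would arise by identifying one of its ends with an end of
  the path on four vertices.\<close>

definition labeled_K2bar_corona_tree :: "'a graph \<Rightarrow> ('a \<Rightarrow> status) \<Rightarrow> bool" where
  "labeled_K2bar_corona_tree G S \<longleftrightarrow> tree G \<and> K2bar_corona G \<and> card {v. stem G v} \<ge> 2 \<and>
     (\<forall>v. leaf G v \<longrightarrow> S v = StA) \<and> (\<forall>v. stem G v \<longrightarrow> S v = StC)"

definition statuses_kept :: "'a graph \<Rightarrow> ('a \<Rightarrow> status) \<Rightarrow> ('a \<Rightarrow> status) \<Rightarrow> bool" where
  "statuses_kept G S' S \<longleftrightarrow> (\<forall>v\<in>verts G. S v = S' v)"

text \<open>Identifying a vertex of \<open>G'\<close> with a vertex of a disjoint copy of \<open>H\<close> amounts to taking the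
  union with a copy of \<open>H\<close> that meets \<open>G'\<close> in exactly that vertex.\<close>

definition identify_at_A ::
  "'a graph \<Rightarrow> ('a \<Rightarrow> status) \<Rightarrow> 'a graph \<Rightarrow> ('a \<Rightarrow> status) \<Rightarrow> 'a graph \<Rightarrow> ('a \<Rightarrow> status) \<Rightarrow> bool"
where
  "identify_at_A G' S' H L G S \<longleftrightarrow> (\<exists>w. verts G' \<inter> verts H = {w} \<and> S' w = StA \<and> L w = StA) \<and>
     verts G = verts G' \<union> verts H \<and> edges G = edges G' \<union> edges H \<and>
     statuses_kept G' S' S \<and> statuses_kept H L S"

text \<open>\<open>opN G' S' G S\<close> says that \<open>(G, S)\<close> results from \<open>(G', S')\<close> by the operation \<open>O\<^sub>N\<close>.\<close>

definition op5 ::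
  "'a graph \<Rightarrow> ('a \<Rightarrow> status) \<Rightarrow> 'a graph \<Rightarrow> ('a \<Rightarrow> status) \<Rightarrow> bool" where
  "op5 G' S' G S \<longleftrightarrow> (\<exists>F J u x. is_F1 x F J \<and> verts G' \<inter> verts F = {} \<and>
     u \<in> verts G' \<and> S' u = StC \<and>
     verts G = verts G' \<union> verts F \<and> edges G = edges G' \<union> edges F \<union> {{u, x}} \<and>
     statuses_kept G' S' S \<and> statuses_kept F J S)"

definition op6 ::
  "'a graph \<Rightarrow> ('a \<Rightarrow> status) \<Rightarrow> 'a graph \<Rightarrow> ('a \<Rightarrow> status) \<Rightarrow> bool" where
  "op6 G' S' G S \<longleftrightarrow> (\<exists>H I. (is_H2 H I \<or> is_H3 H I) \<and> identify_at_A G' S' H I G S)"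

definition op7 ::
  "'a graph \<Rightarrow> ('a \<Rightarrow> status) \<Rightarrow> 'a graph \<Rightarrow> ('a \<Rightarrow> status) \<Rightarrow> bool" where
  "op7 G' S' G S \<longleftrightarrow> (\<exists>H I. is_H2 H I \<and> identify_at_A G' S' H I G S)"

definition op8 ::
  "'a graph \<Rightarrow> ('a \<Rightarrow> status) \<Rightarrow> 'a graph \<Rightarrow> ('a \<Rightarrow> status) \<Rightarrow> bool" where
  "op8 G' S' G S \<longleftrightarrow> (\<exists>H I. labeled_K2bar_corona_tree H I \<and> identify_at_A G' S' H I G S)"

inductive T_01_02 :: "'a graph \<Rightarrow> ('a \<Rightarrow> status) \<Rightarrow> bool" where
  start_H2: "is_H2 G S \<Longrightarrow> T_01_02 G S"
| start_H3: "is_H3 G S \<Longrightarrow> T_01_02 G S"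
| step_op5: "T_01_02 G' S' \<Longrightarrow> op5 G' S' G S \<Longrightarrow> T_01_02 G S"
| step_op6: "T_01_02 G' S' \<Longrightarrow> op6 G' S' G S \<Longrightarrow> T_01_02 G S"

inductive T'_01_02 :: "'a graph \<Rightarrow> ('a \<Rightarrow> status) \<Rightarrow> bool" where
  start_H2: "is_H2 G S \<Longrightarrow> T'_01_02 G S"
| start_corona: "labeled_K2bar_corona_tree G S \<Longrightarrow> T'_01_02 G S"
| step_op7: "T'_01_02 G' S' \<Longrightarrow> op7 G' S' G S \<Longrightarrow> T'_01_02 G S"
| step_op8: "T'_01_02 G' S' \<Longrightarrow> op8 G' S' G S \<Longrightarrow> T'_01_02 G S"

end

theory Submission
  imports Defs
begin

text \<open>Call a set \<open>A\<close> of vertices a splitting if the vertices of \<open>A\<close> attain the values 0 and 1 and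
  all others, the inner vertices, attain 0 and 2. If a graph is glued from two parts at a vertex
  \<open>w \<in> A\<close> that has an inner neighbour in each part, then it has a splitting if and only if both parts
  have one: the value 2 at \<open>w\<close> is always wasteful, and the value 1 there dominates nothing, so
  minimum functions of the parts can be combined at will. Hence both families consist of
  \<open>R_01_02\<close>-graphs. Conversely, in a tree \<open>A\<close> is independent, so cutting at all vertices of \<open>A\<close> of
  degree at least 2 leaves trees in which \<open>A\<close> consists of leaves. In such a tree every inner vertex
  has at most two neighbours in \<open>A\<close>. If all have exactly two, the tree is a corona. Otherwise, since
  the tree is acyclic, some inner vertex \<open>x\<close> with fewer has at most one neighbour of the same kind.
  An exchange argument rules out that \<open>x\<close> has an inner neighbour with two leaves, and then the tree
  is the path on four vertices.

  The two families agree because a corona is built from \<open>H\<^sub>3\<close> by \<open>O\<^sub>5\<close>, one end stem at a time, and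
  because \<open>O\<^sub>5\<close> applied to a graph glued from blocks only enlarges one corona.\<close>

section \<open>Trees\<close>

text \<open>The obstacle in a gluing is that restricting a minimum function to one part can leave
  the shared vertex \<open>w\<close> undominated; raising \<open>w\<close> to 1 repairs this at cost
  1. Because \<open>w\<close> is counted in both parts, their minimum weights add up to exactly 1
  more than that of the whole, and this slack pays for the one repair that can be necessary.

  The values of minimum functions are studied for the second family only. Its operations are all
  gluings at vertices of status A, whereas \<open>op5\<close> adds an edge at a vertex of status C,
  so the first family is compared with the second by pure combinatorics.

  In the converse direction almost every contradiction has the same source: a minimum function is
  altered without extra weight until an outer vertex has value 2 or an inner one has value 1.
  Acyclicity allows values at both ends of an edge to be prescribed: if two minimum functions both
  have no 0 facing a 2 on that edge, they can be exchanged on one side of it.\<close>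

lemma adj_commute: "adj G u v \<longleftrightarrow> adj G v u"
  by (simp add: adj_def insert_commute)

lemma simple_graph_adjD:
  assumes "simple_graph G" "adj G u v"
  shows "u \<in> verts G" "v \<in> verts G" "u \<noteq> v"
  using assms unfolding simple_graph_def adj_def by (metis doubleton_eq_iff)+

lemma simple_graph_finite: "simple_graph G \<Longrightarrow> finite (verts G)"
  by (simp add: simple_graph_def)

lemma simple_graph_edge:
  assumes "simple_graph G" "e \<in> edges G"
  obtains u v where "e = {u, v}" "adj G u v"
  using assms unfolding simple_graph_def adj_def by metis

lemma tree_simple: "tree G \<Longrightarrow> simple_graph G"
  by (simp add: tree_def)

text \<open>Loop erasure: if the vertex put in front already occurs on the path, everything before
  that occurrence is dropped.\<close>

lemma rtranclp_imp_path:
  assumes "R\<^sup>*\<^sup>* u v"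
  shows "\<exists>p. p \<noteq> [] \<and> hd p = u \<and> last p = v \<and> distinct p \<and> successively R p"
  using assms
proof (induction rule: converse_rtranclp_induct)
  case base
  show ?case by (rule exI[of _ "[v]"]) simp
next
  case (step y z)
  then obtain p where p: "p \<noteq> []" "hd p = z" "last p = v" "distinct p" "successively R p"
    by blast
  show ?case
  proof (cases "y \<in> set p")
    case True
    then obtain p1 p2 where "p = p1 @ y # p2" by (meson split_list)
    with p show ?thesis
      by (intro exI[of _ "y # p2"]) (auto simp: successively_append_iff)
  next
    case False
    with p step(1) show ?thesis
      by (intro exI[of _ "y # p"]) (auto simp: successively_Cons)
  qed
qed

lemma connected_graph_closed:
  assumes "connected_graph G" "u \<in> verts G" "u \<in> X"
    and closed: "\<And>x y. x \<in> X \<Longrightarrow> adj G x y \<Longrightarrow> y \<in> X"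
  shows "verts G \<subseteq> X"
proof
  fix v assume "v \<in> verts G"
  with assms have "(adj G)\<^sup>*\<^sup>* u v" by (simp add: connected_graph_def)
  then show "v \<in> X"
    by (induction rule: rtranclp_induct) (use assms(3) closed in auto)
qed

text \<open>The two neighbours are the cyclic predecessor and successor, distinct because a cycle
  has at least 3 vertices. It serves to show that a vertex with a single available neighbour lies on
  no cycle.\<close>

lemma cycle_two_neighbours:
  assumes "is_cycle G p" "v \<in> set p"
  obtains y z where "y \<noteq> z" "y \<in> set p" "z \<in> set p" "adj G v y" "adj G v z"
proof -
  obtain r s where p: "p = r @ v # s" using assms(2) by (meson split_list)
  have c: "length p \<ge> 3" "distinct p" "successively (adj G) p" "adj G (last p) (hd p)"
    using assms(1) by (auto simp: is_cycle_def)
  have prev: "adj G v (last r)" if "r \<noteq> []"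
    using c(3) that unfolding p by (auto simp: successively_append_iff adj_commute)
  have nxt: "adj G v (hd s)" if "s \<noteq> []"
    using c(3) that unfolding p by (cases s) (auto simp: successively_append_iff)
  show thesis
  proof (cases "s = []")
    case True
    with c p have "r \<noteq> []" "hd r \<noteq> last r"
      by (cases r; auto)+
    with c p True prev that[of "last r" "hd r"] show thesis by auto
  next
    case s: False
    show thesis
    proof (cases "r = []")
      case True
      with c p s have "hd s \<noteq> last s" "adj G v (last s)"
        by (cases s; auto simp: adj_commute)+
      with s p True nxt that[of "last s" "hd s"] show thesis by auto
    next
      case False
      then have "hd s \<noteq> last r" using c(2) s p by (metis disjoint_iff distinct_append last_in_set list.set_sel(1) list.set_intros(2))
      with s False prev nxt p that[of "last r" "hd s"] show thesis by auto
    qed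
  qed
qed

definition nbhd :: "'a graph \<Rightarrow> 'a \<Rightarrow> 'a set" where
  "nbhd G v = {u. adj G v u}"

lemma nbhd_iff [simp]: "u \<in> nbhd G v \<longleftrightarrow> adj G v u"
  by (simp add: nbhd_def)

lemma nbhd_finite: "simple_graph G \<Longrightarrow> finite (nbhd G v)"
  by (rule finite_subset[OF _ simple_graph_finite]) (auto dest: simple_graph_adjD)

text \<open>A longest path inside \<open>X\<close> that ends at \<open>c\<close> starts at such an
  \<open>x\<close>: a further neighbour in \<open>X\<close> would prolong the path or close a cycle.
  Fixing the other end at \<open>c\<close> keeps \<open>x\<close> away from \<open>c\<close>, so
  that a chosen vertex can survive the removal of \<open>x\<close>.\<close>

lemma tree_end_vertex:
  assumes "tree G" "X \<subseteq> verts G" "c \<in> X" "c' \<in> X" "adj G c c'"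
  obtains x y where "x \<in> X" "x \<noteq> c" "nbhd G x \<inter> X = {y}"
proof -
  note sim = tree_simple[OF assms(1)]
  define P where "P p \<longleftrightarrow> length p \<ge> 2 \<and> distinct p \<and> set p \<subseteq> X \<and> last p = c \<and> successively (adj G) p"
    for p
  have fX: "finite X" using assms(2) sim finite_subset simple_graph_finite by blast
  have "P [c', c]" using assms simple_graph_adjD[OF sim assms(5)] by (auto simp: P_def adj_commute)
  moreover have "\<forall>p. P p \<longrightarrow> length p < Suc (card X)"
    using fX by (auto simp: P_def less_Suc_eq_le distinct_card[symmetric] intro!: card_mono)
  ultimately obtain p where p: "P p" and mx: "\<And>q. P q \<Longrightarrow> length q \<le> length p"
    using ex_has_greatest_nat[of P _ length] by metis
  from p obtain x y r where pe: "p = x # y # r"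
    unfolding P_def by (metis Suc_le_length_iff numeral_2_eq_2)
  have xc: "x \<noteq> c" using p unfolding P_def pe
    by (metis distinct.simps(2) last_ConsR last_in_set list.distinct(1))
  have "z = y" if z: "adj G x z" "z \<in> X" for z
  proof (rule ccontr)
    assume zy: "z \<noteq> y"
    have zx: "z \<noteq> x" using simple_graph_adjD[OF sim z(1)] by auto
    show False
    proof (cases "z \<in> set p")
      case False
      with p z have "P (z # p)" by (auto simp: P_def pe adj_commute)
      then show False using mx by fastforce
    next
      case True
      with zx zy obtain r1 r2 where r: "r = r1 @ z # r2" unfolding pe
        by (metis set_ConsD split_list)
      have "is_cycle G (x # y # r1 @ [z])"
        using p z assms(2) unfolding is_cycle_def P_def pe r
        by (auto simp: successively_append_iff successively_Cons adj_commute hd_append split: if_splits)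
      with assms(1) show False by (auto simp: tree_def)
    qed
  qed
  moreover have x: "adj G x y" "y \<in> X" "x \<in> X" using p by (auto simp: P_def pe)
  ultimately have "nbhd G x \<inter> X = {y}" unfolding nbhd_def by blast
  with that xc x(3) show thesis by blast
qed

section \<open>Subtrees: deleting a branch and cutting along an edge\<close>

definition induced :: "'a graph \<Rightarrow> 'a set \<Rightarrow> 'a graph" where
  "induced G X = \<lparr>verts = X, edges = {e \<in> edges G. e \<subseteq> X}\<rparr>"

lemma induced_simps [simp]:
  "verts (induced G X) = X"
  "adj (induced G X) u v \<longleftrightarrow> adj G u v \<and> u \<in> X \<and> v \<in> X"
  "edges (induced G X) = {e \<in> edges G. e \<subseteq> X}"
  by (auto simp: induced_def adj_def)

lemma simple_induced:
  assumes "simple_graph G" "X \<subseteq> verts G" "X \<noteq> {}"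
  shows "simple_graph (induced G X)"
  using assms unfolding simple_graph_def induced_simps
  by (auto intro: finite_subset) (metis insert_subset)

lemma acyclic_mono:
  assumes "\<nexists>p. is_cycle G p" "\<And>u v. adj H u v \<Longrightarrow> adj G u v" "verts H \<subseteq> verts G"
  shows "\<nexists>p. is_cycle H p"
proof
  assume "\<exists>p. is_cycle H p"
  then obtain p where "is_cycle H p" ..
  then have "is_cycle G p" using assms(2,3)
    by (auto simp: is_cycle_def intro: successively_mono)
  with assms(1) show False by blast
qed

lemma tree_induced:
  assumes "tree G" "X \<subseteq> verts G" "X \<noteq> {}" "connected_graph (induced G X)"
  shows "tree (induced G X)"
  using assms acyclic_mono[of G "induced G X"] simple_induced[of G X]
  by (auto simp: tree_def)

lemma connected_graphI:
  assumes "\<And>v. v \<in> verts G \<Longrightarrow> (adj G)\<^sup>*\<^sup>* v u"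
  shows "connected_graph G"
proof -
  have "symp (adj G)" by (auto simp: symp_def adj_commute)
  then have "symp (adj G)\<^sup>*\<^sup>*" by (rule symp_rtranclp)
  then show ?thesis unfolding connected_graph_def
    by (meson assms rtranclp_trans sympD)
qed

text \<open>A walk towards \<open>u\<close> from a remaining vertex can enter \<open>X\<close> only
  from \<open>u\<close> itself, so its portion up to the first visit of \<open>u\<close> avoids
  \<open>X\<close>.\<close>

lemma tree_delete:
  assumes "tree G" "u \<in> verts G" "u \<notin> X"
    and cut: "\<And>x y. x \<in> X \<Longrightarrow> y \<notin> X \<Longrightarrow> adj G x y \<Longrightarrow> y = u"
  shows "tree (induced G (verts G - X))"
proof -
  note sim = tree_simple[OF assms(1)]
  let ?H = "induced G (verts G - X)"
  have "connected_graph ?H"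
  proof (rule connected_graphI)
    fix v assume v: "v \<in> verts ?H"
    then have "(adj G)\<^sup>*\<^sup>* v u" using assms by (auto simp: tree_def connected_graph_def)
    moreover have "v \<notin> X" using v by simp
    ultimately show "(adj ?H)\<^sup>*\<^sup>* v u"
    proof (induction rule: converse_rtranclp_induct)
      case (step y z)
      show ?case
      proof (cases "z \<in> X")
        case True
        with cut step show ?thesis by (auto simp: adj_commute)
      next
        case False
        then have "adj ?H y z" using step simple_graph_adjD[OF sim step(1)] by auto
        with step False show ?thesis by (meson converse_rtranclp_into_rtranclp)
      qed
    qed simp
  qed
  then show ?thesis using assms(1-3) by (intro tree_induced) auto
qed

text \<open>The side of \<open>v\<close> when an edge \<open>{u, v}\<close> of a tree is removed.\<close>

definition beyond :: "'a graph \<Rightarrow> 'a \<Rightarrow> 'a \<Rightarrow> 'a set" where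
  "beyond G u v = {x. (\<lambda>a b. adj G a b \<and> b \<noteq> u)\<^sup>*\<^sup>* v x}"

lemma beyond_refl: "v \<in> beyond G u v"
  by (simp add: beyond_def)

lemma beyond_props:
  assumes "simple_graph G" "adj G u v"
  shows "u \<notin> beyond G u v" "beyond G u v \<subseteq> verts G"
proof -
  have "x \<noteq> u \<and> x \<in> verts G" if "x \<in> beyond G u v" for x
    using that unfolding beyond_def mem_Collect_eq
    by (induction rule: rtranclp_induct) (use assms simple_graph_adjD in fastforce)+
  then show "u \<notin> beyond G u v" "beyond G u v \<subseteq> verts G" by auto
qed

text \<open>A second edge from the branch to \<open>u\<close>, at some \<open>x\<close> other than
  \<open>v\<close>, would close a path from \<open>v\<close> to \<open>x\<close> avoiding
  \<open>u\<close> to a cycle; it has at least 3 vertices because \<open>x\<close> and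
  \<open>v\<close> differ.\<close>

lemma beyond_cut:
  assumes "tree G" "adj G u v" "x \<in> beyond G u v" "y \<notin> beyond G u v" "adj G x y"
  shows "x = v" "y = u"
proof -
  note sim = tree_simple[OF assms(1)]
  let ?R = "\<lambda>a b. adj G a b \<and> b \<noteq> u"
  show y: "y = u"
    using assms(3-5) unfolding beyond_def by (auto intro: rtranclp.rtrancl_into_rtrancl)
  show "x = v"
  proof (rule ccontr)
    assume xv: "x \<noteq> v"
    obtain p where p: "p \<noteq> []" "hd p = v" "last p = x" "distinct p" "successively ?R p"
      using rtranclp_imp_path[of ?R v x] assms(3) by (auto simp: beyond_def)
    have sub: "set p \<subseteq> verts G \<and> u \<notin> set p"
      using p(1,2,5)
    proof (induction p rule: rev_induct)
      case (snoc z q)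
      show ?case
      proof (cases "q = []")
        case True
        with snoc simple_graph_adjD[OF sim assms(2)] show ?thesis by auto
      next
        case False
        with snoc have "?R (last q) z" "set q \<subseteq> verts G \<and> u \<notin> set q"
          by (auto simp: successively_append_iff)
        with simple_graph_adjD[OF sim] show ?thesis by auto
      qed
    qed simp
    have "successively (adj G) p" using p(5) by (rule successively_mono) auto
    moreover have "length p \<ge> 2" using p xv by (cases p; cases "tl p") auto
    ultimately have "is_cycle G (u # p)"
      using p sub assms(2,5) y simple_graph_adjD[OF sim assms(2)]
      by (auto simp: is_cycle_def successively_Cons)
    with assms(1) show False by (auto simp: tree_def)
  qed
qed

text \<open>The vertex \<open>u\<close> is retained with the branch because it belongs to both parts
  when the tree is later viewed as a gluing at \<open>u\<close>.\<close>

lemma tree_induced_beyond: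
  assumes "tree G" "adj G u v"
  shows "tree (induced G (insert u (beyond G u v)))"
proof -
  note sim = tree_simple[OF assms(1)]
  let ?X = "insert u (beyond G u v)"
  let ?H = "induced G ?X"
  have reach: "(adj ?H)\<^sup>*\<^sup>* v x" if "x \<in> beyond G u v" for x
    using that[unfolded beyond_def mem_Collect_eq]
  proof (induction rule: rtranclp_induct)
    case (step y z)
    then have "adj ?H y z" by (auto simp: beyond_def intro: rtranclp.rtrancl_into_rtrancl)
    with step show ?case by (meson rtranclp.rtrancl_into_rtrancl)
  qed simp
  have "(adj ?H)\<^sup>*\<^sup>* v x" if "x \<in> verts ?H" for x
  proof (cases "x = u")
    case True
    then have "adj ?H v x" using assms(2) by (auto simp: adj_commute beyond_refl)
    then show ?thesis by blast
  qed (use that reach in auto)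
  then have "(adj ?H)\<^sup>*\<^sup>* x v" if "x \<in> verts ?H" for x
    using that by (metis adj_commute symp_rtranclp sympD sympI)
  then have "connected_graph ?H" by (rule connected_graphI)
  then show ?thesis
    using assms(1) beyond_props[OF sim assms(2)] simple_graph_adjD[OF sim assms(2)]
    by (intro tree_induced) auto
qed

section \<open>Values of minimum Roman dominating functions\<close>

lemma gamma_R_function_iff:
  "gamma_R_function G f \<longleftrightarrow> RDF G f \<and> (\<forall>g. RDF G g \<longrightarrow> weight G f \<le> weight G g)"
proof
  assume "gamma_R_function G f"
  then show "RDF G f \<and> (\<forall>g. RDF G g \<longrightarrow> weight G f \<le> weight G g)"
    unfolding gamma_R_function_def gamma_R_def by (auto intro: Least_le)
next
  assume f: "RDF G f \<and> (\<forall>g. RDF G g \<longrightarrow> weight G f \<le> weight G g)"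
  then have "gamma_R G = weight G f"
    unfolding gamma_R_def by (intro Least_equality) auto
  with f show "gamma_R_function G f" by (simp add: gamma_R_function_def)
qed

lemma gamma_R_function_RDF: "gamma_R_function G f \<Longrightarrow> RDF G f"
  by (simp add: gamma_R_function_def)

lemma gamma_R_function_le: "gamma_R_function G f \<Longrightarrow> RDF G g \<Longrightarrow> weight G f \<le> weight G g"
  by (simp add: gamma_R_function_iff)

lemma gamma_R_function_eqI:
  "gamma_R_function G f \<Longrightarrow> RDF G g \<Longrightarrow> weight G g \<le> weight G f \<Longrightarrow> gamma_R_function G g"
  by (meson gamma_R_function_iff order_trans)

text \<open>The additive form avoids truncated subtraction on the natural numbers.\<close>

lemma weight_upd:
  assumes "finite (verts G)" "v \<in> verts G"
  shows "weight G (f(v := k)) + f v = weight G f + k"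
proof -
  have "(\<Sum>u\<in>verts G - {v}. (f(v := k)) u) = (\<Sum>u\<in>verts G - {v}. f u)"
    by (rule sum.cong) auto
  then show ?thesis
    using sum.remove[OF assms, of f] sum.remove[OF assms, of "f(v := k)"] by (simp add: weight_def)
qed

lemma RDF_range: "RDF G f \<Longrightarrow> v \<in> verts G \<Longrightarrow> f v = 0 \<or> f v = 1 \<or> f v = 2"
  unfolding RDF_def by blast

lemma RDF_dominated: "RDF G f \<Longrightarrow> v \<in> verts G \<Longrightarrow> f v = 0 \<Longrightarrow> \<exists>u. adj G v u \<and> f u = 2"
  unfolding RDF_def by blast

lemma RDF_I:
  assumes "simple_graph G" "\<And>v. v \<in> verts G \<Longrightarrow> f v = 0 \<or> f v = 1 \<or> f v = 2"
    "\<And>v. v \<in> verts G \<Longrightarrow> f v = 0 \<Longrightarrow> \<exists>u. adj G v u \<and> f u = 2"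
  shows "RDF G f"
  unfolding RDF_def
proof (intro conjI subsetI ballI impI)
  fix x assume "x \<in> f ` verts G"
  then obtain v where "x = f v" "v \<in> verts G" by blast
  with assms(2)[of v] show "x \<in> {0, 1, 2}" by simp
next
  fix v assume v: "v \<in> verts G" "f v = 0"
  then obtain u where "adj G v u" "f u = 2" using assms(3) by blast
  then show "\<exists>u\<in>verts G. adj G v u \<and> f u = 2"
    using simple_graph_adjD(2)[OF assms(1)] by blast
qed

definition attained :: "'a graph \<Rightarrow> 'a \<Rightarrow> nat set" where
  "attained G v = {f v | f. gamma_R_function G f}"

lemma attained_iff: "k \<in> attained G v \<longleftrightarrow> (\<exists>f. gamma_R_function G f \<and> f v = k)"
  by (auto simp: attained_def)

lemma attained_eqI:
  assumes "gamma_R_function G f" "f v = k" "gamma_R_function G g" "g v = l"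
    and "\<And>h. gamma_R_function G h \<Longrightarrow> h v = k \<or> h v = l"
  shows "attained G v = {k, l}"
  using assms unfolding attained_def by blast

lemma VX_iff: "v \<in> VX X G \<longleftrightarrow> v \<in> verts G \<and> attained G v = X"
  by (simp add: VX_def attained_def)

text \<open>The set is an explicit argument so that it can be restricted to parts and united over
  them. Nonemptiness of the two classes is treated separately, in
  \<open>R_01_02_graph_iff\<close>.\<close>

definition splits :: "'a graph \<Rightarrow> 'a set \<Rightarrow> bool" where
  "splits G A \<longleftrightarrow> A \<subseteq> verts G \<and> (\<forall>v\<in>A. attained G v = {0, 1}) \<and>
     (\<forall>v\<in>verts G - A. attained G v = {0, 2})"

lemma R_01_02_graph_iff:
  "R_01_02_graph G \<longleftrightarrow> (\<exists>A. splits G A \<and> A \<noteq> {} \<and> verts G - A \<noteq> {})"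
proof
  assume "R_01_02_graph G"
  then have R: "verts G = VX {0, 1} G \<union> VX {0, 2} G" "VX {0, 1} G \<noteq> {}" "VX {0, 2} G \<noteq> {}"
    by (auto simp: R_01_02_graph_def)
  have "VX {0, 1} G \<inter> VX {0, 2} G = {}"
  proof (rule equals0I)
    fix v assume "v \<in> VX {0, 1} G \<inter> VX {0, 2} G"
    then have "{0, 1} = {0, 2::nat}" by (metis IntD1 IntD2 VX_iff)
    then have "1 \<in> {0, 2::nat}" by (metis insertI1 insert_commute)
    then show False by simp
  qed
  with R(1) have D: "verts G - VX {0, 1} G = VX {0, 2} G" by (metis Diff_triv Un_Diff Diff_cancel Un_empty_left inf_commute)
  have "splits G (VX {0, 1} G)" unfolding splits_def D by (simp add: VX_iff subset_iff)
  with R(2,3) D show "\<exists>A. splits G A \<and> A \<noteq> {} \<and> verts G - A \<noteq> {}" by metis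
next
  assume "\<exists>A. splits G A \<and> A \<noteq> {} \<and> verts G - A \<noteq> {}"
  then obtain A where A: "splits G A" "A \<noteq> {}" "verts G - A \<noteq> {}" by blast
  have "A \<subseteq> VX {0, 1} G" "verts G - A \<subseteq> VX {0, 2} G"
    using A(1) unfolding splits_def by (auto simp: VX_iff)
  moreover have "VX {0, 1} G \<subseteq> verts G" "VX {0, 2} G \<subseteq> verts G" by (auto simp: VX_iff)
  ultimately show "R_01_02_graph G" using A unfolding R_01_02_graph_def by blast
qed

lemma splits_outer: "splits G A \<Longrightarrow> gamma_R_function G f \<Longrightarrow> v \<in> A \<Longrightarrow> f v = 0 \<or> f v = 1"
proof -
  assume "splits G A" "gamma_R_function G f" "v \<in> A"
  then have "attained G v = {0, 1}" "f v \<in> attained G v"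
    by (simp add: splits_def, metis attained_iff)
  then show ?thesis by simp
qed

lemma splits_inner:
  "splits G A \<Longrightarrow> gamma_R_function G f \<Longrightarrow> v \<in> verts G \<Longrightarrow> v \<notin> A \<Longrightarrow> f v = 0 \<or> f v = 2"
proof -
  assume "splits G A" "gamma_R_function G f" "v \<in> verts G" "v \<notin> A"
  then have "attained G v = {0, 2}" "f v \<in> attained G v"
    by (simp add: splits_def, metis attained_iff)
  then show ?thesis by simp
qed

lemma splits_outer_ex:
  assumes "splits G A" "v \<in> A" "k = 0 \<or> k = 1"
  obtains f where "gamma_R_function G f" "f v = k"
proof -
  have "attained G v = {0, 1}" using assms by (simp add: splits_def)
  then have "k \<in> attained G v" using assms(3) by auto
  then show ?thesis using that by (auto simp: attained_iff)
qed

lemma splits_inner_ex: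
  assumes "splits G A" "v \<in> verts G" "v \<notin> A" "k = 0 \<or> k = 2"
  obtains f where "gamma_R_function G f" "f v = k"
proof -
  have "attained G v = {0, 2}" using assms by (simp add: splits_def)
  then have "k \<in> attained G v" using assms(4) by auto
  then show ?thesis using that by (auto simp: attained_iff)
qed

lemma splits_two_notin: "splits G A \<Longrightarrow> gamma_R_function G f \<Longrightarrow> v \<in> verts G \<Longrightarrow> f v = 2 \<Longrightarrow> v \<notin> A"
  using splits_outer by fastforce

text \<open>A 1 next to a 2 is wasteful: lowering it to 0 leaves it dominated, and no other vertex
  relied on it.\<close>

lemma outer_one_not_adj_two:
  assumes "simple_graph G" "gamma_R_function G f" "adj G a d" "f a = 1"
  shows "f d \<noteq> 2"
proof
  assume d: "f d = 2"
  note aD = simple_graph_adjD[OF assms(1,3)]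
  note R = gamma_R_function_RDF[OF assms(2)]
  have "RDF G (f(a := 0))"
  proof (rule RDF_I[OF assms(1)])
    fix v assume v: "v \<in> verts G"
    then show "(f(a := 0)) v = 0 \<or> (f(a := 0)) v = 1 \<or> (f(a := 0)) v = 2" using RDF_range[OF R] by simp
    assume "(f(a := 0)) v = 0"
    then show "\<exists>u. adj G v u \<and> (f(a := 0)) u = 2"
      using RDF_dominated[OF R v] assms(3,4) d aD by (cases "v = a") (fastforce simp: fun_upd_def)+
  qed
  from gamma_R_function_le[OF assms(2) this] weight_upd[OF simple_graph_finite[OF assms(1)] aD(1), of f 0]
  show False using assms(4) by simp
qed

section \<open>Gluing two graphs at a shared vertex\<close>

locale gluing =
  fixes G1 G2 G :: "'a graph" and w :: 'a
  assumes simple1: "simple_graph G1" and simple2: "simple_graph G2"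
    and inter: "verts G1 \<inter> verts G2 = {w}"
    and verts: "verts G = verts G1 \<union> verts G2"
    and edges: "edges G = edges G1 \<union> edges G2"
begin

lemma sym: "gluing G2 G1 G w"
  using simple1 simple2 inter verts edges by unfold_locales auto

lemma adj_iff: "adj G u v \<longleftrightarrow> adj G1 u v \<or> adj G2 u v"
  by (auto simp: adj_def edges)

lemma simple: "simple_graph G"
  using simple1 simple2 unfolding simple_graph_def verts edges ball_Un by (meson UnCI finite_UnI Un_empty)

lemma w_in: "w \<in> verts G1" "w \<in> verts G2" "w \<in> verts G"
  using inter verts by auto

lemma weight_split: "weight G f + f w = weight G1 f + weight G2 f"
  using sum.union_inter[of "verts G1" "verts G2" f] simple1 simple2
  by (simp add: weight_def verts inter simple_graph_finite)

lemma adj_left: "adj G u v \<Longrightarrow> u \<in> verts G1 \<Longrightarrow> u \<noteq> w \<Longrightarrow> adj G1 u v"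
  using adj_iff simple_graph_adjD[OF simple2] inter by blast

text \<open>Every vertex of \<open>G1\<close> other than \<open>w\<close> keeps all its neighbours,
  so only the domination of \<open>w\<close> itself can be lost.\<close>

lemma RDF_left:
  assumes "RDF G f" "f w = 0 \<Longrightarrow> \<exists>u. adj G1 w u \<and> f u = 2"
  shows "RDF G1 f"
proof (rule RDF_I[OF simple1])
  fix v assume v: "v \<in> verts G1"
  then show "f v = 0 \<or> f v = 1 \<or> f v = 2" using assms(1) verts by (auto dest: RDF_range)
  assume 0: "f v = 0"
  show "\<exists>u. adj G1 v u \<and> f u = 2"
  proof (cases "v = w")
    case True
    with 0 assms(2) show ?thesis by simp
  next
    case False
    have "v \<in> verts G" using v verts by simp
    with RDF_dominated[OF assms(1) _ 0] False v adj_left show ?thesis by metis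
  qed
qed

text \<open>The repair for the case that \<open>w\<close> is dominated from \<open>G2\<close> alone.
  As \<open>w\<close> had value 0, overwriting it destroys no 2.\<close>

lemma RDF_left_upd:
  assumes "RDF G f" "f w = 0"
  shows "RDF G1 (f(w := 1))"
proof (rule RDF_I[OF simple1])
  fix v assume v: "v \<in> verts G1"
  then show "(f(w := 1)) v = 0 \<or> (f(w := 1)) v = 1 \<or> (f(w := 1)) v = 2"
    using assms(1) verts by (auto dest: RDF_range)
  assume "(f(w := 1)) v = 0"
  then have "v \<noteq> w" "f v = 0" by (auto split: if_splits)
  with RDF_dominated[OF assms(1), of v] v verts obtain u where "adj G v u" "f u = 2" by blast
  with \<open>v \<noteq> w\<close> v adj_left assms(2) show "\<exists>u. adj G1 v u \<and> (f(w := 1)) u = 2"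
    by (intro exI[of _ u]) auto
qed

lemma weight_left_upd: "f w = 0 \<Longrightarrow> weight G1 (f(w := 1)) = weight G1 f + 1"
  using weight_upd[OF simple_graph_finite[OF simple1] w_in(1), of f 1] by simp

definition join :: "('a \<Rightarrow> nat) \<Rightarrow> ('a \<Rightarrow> nat) \<Rightarrow> 'a \<Rightarrow> nat" where
  "join f g v = (if v \<in> verts G1 then f v else g v)"

text \<open>A value 1 at \<open>w\<close> dominates nothing, so it can be overridden by the other part.\<close>

lemma RDF_join:
  assumes "RDF G1 f" "RDF G2 g" "g w = 1"
  shows "RDF G (join f g)"
proof (rule RDF_I[OF simple])
  fix v assume v: "v \<in> verts G"
  then show "join f g v = 0 \<or> join f g v = 1 \<or> join f g v = 2"
    using assms verts by (auto simp: join_def dest: RDF_range)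
  assume 0: "join f g v = 0"
  show "\<exists>u. adj G v u \<and> join f g u = 2"
  proof (cases "v \<in> verts G1")
    case True
    with 0 RDF_dominated[OF assms(1)] obtain u where "adj G1 v u" "f u = 2" by (auto simp: join_def)
    with simple_graph_adjD[OF simple1] show ?thesis by (auto simp: join_def adj_iff)
  next
    case False
    with 0 v verts RDF_dominated[OF assms(2), of v] obtain u where u: "adj G2 v u" "g u = 2"
      by (auto simp: join_def)
    then have "u \<noteq> w" using assms(3) by auto
    with simple_graph_adjD[OF simple2 u(1)] inter have "u \<notin> verts G1" by blast
    with u show ?thesis by (auto simp: join_def adj_iff)
  qed
qed

text \<open>The extra 1 is the value of \<open>g\<close> at \<open>w\<close>, which the joined
  function discards.\<close>

lemma weight_join:
  assumes "g w = 1"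
  shows "weight G (join f g) + 1 = weight G1 f + weight G2 g"
proof -
  have "weight G1 (join f g) = weight G1 f" by (simp add: weight_def join_def)
  moreover have "weight G2 (join f g) + g w = weight G2 (g(w := f w)) + g w"
    unfolding weight_def using inter by (intro arg_cong2[where f = "(+)"] sum.cong) (auto simp: join_def)
  moreover have "join f g w = f w" using w_in by (simp add: join_def)
  ultimately show ?thesis
    using weight_split[of "join f g"] weight_upd[OF simple_graph_finite[OF simple2] w_in(2), of g "f w"] assms
    by simp
qed

lemma attained_join:
  assumes "\<And>g. gamma_R_function G1 g \<Longrightarrow> gamma_R_function G (join g f)" "v \<in> verts G1"
  shows "attained G1 v \<subseteq> attained G v"
proof
  fix k assume "k \<in> attained G1 v"
  then obtain g where "gamma_R_function G1 g" "g v = k" by (auto simp: attained_iff)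
  with assms have "gamma_R_function G (join g f)" "join g f v = k" by (simp_all add: join_def)
  then show "k \<in> attained G v" unfolding attained_iff by blast
qed

text \<open>If \<open>f w = 0\<close>, one part dominates \<open>w\<close> and the other is repaired
  at cost 1; if \<open>f w = 1\<close>, both restrictions are legal and the shared 1 is counted
  twice. For \<open>f w = 2\<close> the bound is sharper by 1, which will exclude that value from
  minimum functions of \<open>G\<close>.\<close>

lemma splits_glue_lower:
  assumes s1: "splits G1 A1" and s2: "splits G2 A2" and w: "w \<in> A1" "w \<in> A2"
    and f1: "gamma_R_function G1 f1" and f2: "gamma_R_function G2 f2" and f: "RDF G f"
  shows "weight G1 f1 + weight G2 f2 \<le> weight G f + (if f w = 2 then 0 else 1)"
proof -
  interpret flip: gluing G2 G1 G w by (rule sym)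
  consider "f w = 0" | "f w = 1" | "f w = 2" using RDF_range[OF f w_in(3)] by metis
  then show ?thesis
  proof cases
    case 1
    with RDF_dominated[OF f w_in(3)] adj_iff
    consider "\<exists>u. adj G1 w u \<and> f u = 2" | "\<exists>u. adj G2 w u \<and> f u = 2" by blast
    then show ?thesis
    proof cases
      case A: 1
      then have "RDF G1 f" using RDF_left[OF f] by blast
      with gamma_R_function_le[OF f1] gamma_R_function_le[OF f2 flip.RDF_left_upd[OF f]] 1
        flip.weight_left_upd[of f] weight_split[of f]
      show ?thesis by force
    next
      case 2
      then have "RDF G2 f" using flip.RDF_left[OF f] by blast
      with gamma_R_function_le[OF f2] gamma_R_function_le[OF f1 RDF_left_upd[OF f]] 1
        weight_left_upd[of f] weight_split[of f]
      show ?thesis by force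
    qed
  next
    case 2
    with RDF_left[OF f] flip.RDF_left[OF f] gamma_R_function_le[OF f1] gamma_R_function_le[OF f2]
      weight_split[of f] show ?thesis by force
  next
    case 3
    \<comment> \<open>Neither part attains 2 at \<open>w\<close>, so both restrictions exceed their
      minimum by at least 1; this outweighs counting the 2 at \<open>w\<close> twice.\<close>
    have "\<not> gamma_R_function G1 f" "\<not> gamma_R_function G2 f"
      using 3 splits_outer[OF s1 _ w(1)] splits_outer[OF s2 _ w(2)] by fastforce+
    then have "weight G1 f1 < weight G1 f" "weight G2 f2 < weight G2 f"
      using gamma_R_function_eqI[OF f1] gamma_R_function_eqI[OF f2] RDF_left[OF f] flip.RDF_left[OF f] 3
      by (meson not_less zero_neq_numeral order.refl | force)+
    with weight_split[of f] 3 show ?thesis by simp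
  qed
qed

text \<open>Joining with a fixed \<open>f2\<close> that has 1 at \<open>w\<close> extends every
  minimum function of \<open>G1\<close>. Conversely a minimum function of \<open>G\<close> restricts
  to one of \<open>G1\<close>, possibly after the repair at \<open>w\<close>, because the minima of
  the parts add up to that of \<open>G\<close> plus 1.\<close>

lemma splits_glue_left:
  assumes s1: "splits G1 A1" and s2: "splits G2 A2" and w: "w \<in> A1" "w \<in> A2"
    and v: "v \<in> verts G1"
  shows "attained G v = attained G1 v"
proof -
  interpret flip: gluing G2 G1 G w by (rule sym)
  obtain f1 where f1: "gamma_R_function G1 f1" "f1 w = 1" using splits_outer_ex[OF s1 w(1)] by blast
  obtain f2 where f2: "gamma_R_function G2 f2" "f2 w = 1" using splits_outer_ex[OF s2 w(2)] by blast
  note lower = splits_glue_lower[OF s1 s2 w f1(1) f2(1)]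
  have join: "gamma_R_function G (join f f2)" if f: "gamma_R_function G1 f" for f
    unfolding gamma_R_function_iff
  proof (intro conjI allI impI)
    show "RDF G (join f f2)" using RDF_join f f2 gamma_R_function_RDF by blast
    fix g assume "RDF G g"
    from lower[OF this] weight_join[of f2 f, OF f2(2)]
      gamma_R_function_le[OF f gamma_R_function_RDF[OF f1(1)]]
    show "weight G (join f f2) \<le> weight G g" by (auto split: if_splits)
  qed
  have val: "weight G f + 1 = weight G1 f1 + weight G2 f2" "f w \<noteq> 2" if f: "gamma_R_function G f" for f
    using lower[OF gamma_R_function_RDF[OF f]] weight_join[of f2 f1, OF f2(2)]
      gamma_R_function_le[OF f gamma_R_function_RDF[OF join[OF f1(1)]]]
    by (auto split: if_splits)
  have "attained G1 v \<subseteq> attained G v" by (rule attained_join[OF join v])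
  moreover have "f v \<in> attained G1 v" if f: "gamma_R_function G f" for f
  proof (cases "v = w")
    \<comment> \<open>The repair may change the value at \<open>w\<close>, so \<open>w\<close> is
      treated apart: here it suffices that \<open>G1\<close> attains both 0 and 1 and that
      \<open>f w\<close> is not 2.\<close>
    case True
    have "attained G1 w = {0, 1}" using s1 w by (simp add: splits_def)
    with True val(2)[OF f] RDF_range[OF gamma_R_function_RDF[OF f] w_in(3)] show ?thesis by auto
  next
    case False
    note R = gamma_R_function_RDF[OF f]
    note le1 = gamma_R_function_le[OF f1(1)] and le2 = gamma_R_function_le[OF f2(1)]
    consider "f w = 0" | "f w = 1" using RDF_range[OF R w_in(3)] val(2)[OF f] by metis
    then show ?thesis
    proof cases
      case 1
      with RDF_dominated[OF R w_in(3)] adj_iff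
      consider "\<exists>u. adj G1 w u \<and> f u = 2" | "\<exists>u. adj G2 w u \<and> f u = 2" by blast
      then show ?thesis
      proof cases
        case A: 1
        then have r: "RDF G1 f" using RDF_left[OF R] by blast
        have "weight G1 f \<le> weight G1 f1"
          using val(1)[OF f] le2[OF flip.RDF_left_upd[OF R 1]] flip.weight_left_upd[of f, OF 1] weight_split[of f] 1
          by simp
        with r have "gamma_R_function G1 f" using gamma_R_function_eqI[OF f1(1)] by blast
        then show ?thesis by (auto simp: attained_iff)
      next
        case 2
        then have "RDF G2 f" using flip.RDF_left[OF R] by blast
        then have "weight G1 (f(w := 1)) \<le> weight G1 f1"
          using val(1)[OF f] le2[of f] weight_left_upd[of f, OF 1] weight_split[of f] 1
          by simp
        then have "gamma_R_function G1 (f(w := 1))"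
          using gamma_R_function_eqI[OF f1(1) RDF_left_upd[OF R 1]] by blast
        moreover have "(f(w := 1)) v = f v" using False by simp
        ultimately show ?thesis unfolding attained_iff by blast
      qed
    next
      case 2
      then have "RDF G1 f" "RDF G2 f" using RDF_left[OF R] flip.RDF_left[OF R] by auto
      moreover from this have "weight G1 f \<le> weight G1 f1"
        using val(1)[OF f] le2 weight_split[of f] 2 by fastforce
      ultimately have "gamma_R_function G1 f" using gamma_R_function_eqI[OF f1(1)] by blast
      then show ?thesis by (auto simp: attained_iff)
    qed
  qed
  ultimately show ?thesis by (auto simp: attained_def)
qed

lemma splits_glue:
  assumes "splits G1 A1" "splits G2 A2" "w \<in> A1" "w \<in> A2"
  shows "splits G (A1 \<union> A2)"
proof -
  interpret flip: gluing G2 G1 G w by (rule sym)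
  note left = splits_glue_left[OF assms] and right = flip.splits_glue_left[OF assms(2,1,4,3)]
  show ?thesis
    unfolding splits_def verts
  proof (intro conjI ballI)
    have "A1 \<subseteq> verts G1" "A2 \<subseteq> verts G2" using assms by (simp_all add: splits_def)
    note sub = this
    then show "A1 \<union> A2 \<subseteq> verts G1 \<union> verts G2" by blast
    fix v
    show "attained G v = {0, 1}" if "v \<in> A1 \<union> A2"
      using that sub left[of v] right[of v] assms(1,2) by (auto simp: splits_def)
    show "attained G v = {0, 2}" if "v \<in> verts G1 \<union> verts G2 - (A1 \<union> A2)"
      using that left[of v] right[of v] assms(1,2) by (auto simp: splits_def)
  qed
qed

text \<open>A cheaper function on \<open>G1\<close> could be joined with \<open>f\<close> on the
  other part, since the 1 at \<open>w\<close> may be overridden there.\<close>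

lemma restrict_gamma:
  assumes "gamma_R_function G f" "f w = 1"
  shows "gamma_R_function G1 f"
proof -
  interpret flip: gluing G2 G1 G w by (rule sym)
  note R = gamma_R_function_RDF[OF assms(1)]
  have R12: "RDF G1 f" "RDF G2 f" using RDF_left[OF R] flip.RDF_left[OF R] assms(2) by auto
  show ?thesis unfolding gamma_R_function_iff
  proof (intro conjI allI impI R12)
    fix g assume "RDF G1 g"
    from gamma_R_function_le[OF assms(1) RDF_join[OF this R12(2) assms(2)]]
      weight_join[of f g, OF assms(2)] weight_split[of f] assms(2)
    show "weight G1 f \<le> weight G1 g" by simp
  qed
qed

text \<open>The converse of gluing. The inner neighbour \<open>d\<close> on the side of
  \<open>G1\<close> is needed for one value only: it guarantees that 0 at \<open>w\<close> is
  attained within \<open>G1\<close>.\<close>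

lemma splits_unglue:
  assumes s: "splits G A" and w: "w \<in> A" and d: "adj G1 w d" "d \<notin> A"
  shows "splits G1 (A \<inter> verts G1)"
proof -
  interpret flip: gluing G2 G1 G w by (rule sym)
  obtain f where f: "gamma_R_function G f" "f w = 1" using splits_outer_ex[OF s w] by blast
  have f1: "gamma_R_function G1 f" and f2: "gamma_R_function G2 f"
    using restrict_gamma[OF f] flip.restrict_gamma[OF f] by auto
  have join: "gamma_R_function G (join g f)" if g: "gamma_R_function G1 g" for g
  proof (rule gamma_R_function_eqI[OF f(1)])
    show "RDF G (join g f)" using RDF_join f f2 g gamma_R_function_RDF by blast
    show "weight G (join g f) \<le> weight G f"
      using weight_join[of f g, OF f(2)] weight_split[of f] f(2)
        gamma_R_function_le[OF g gamma_R_function_RDF[OF f1]] by simp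
  qed
  have "attained G1 v = attained G v" if v: "v \<in> verts G1" for v
  proof
    show "attained G1 v \<subseteq> attained G v" by (rule attained_join[OF join v])
    show "attained G v \<subseteq> attained G1 v"
    proof
      fix k assume "k \<in> attained G v"
      then obtain g where g: "gamma_R_function G g" "g v = k" by (auto simp: attained_iff)
      note R = gamma_R_function_RDF[OF g(1)]
      have wt: "weight G g = weight G f"
        using g(1) f(1) by (simp add: gamma_R_function_def)
      \<comment> \<open>As \<open>f w = 1\<close>, the minima of the parts add up to
        \<open>weight G f + 1\<close>. Legal functions on the parts with that total must both be
        minimum.\<close>
      have eq: "gamma_R_function G1 g'" if "g w = 0" "RDF G1 g'" "RDF G2 g''"
        "weight G1 g' + weight G2 g'' = weight G1 g + weight G2 g + 1" for g' g''
        by (rule gamma_R_function_eqI[OF f1 that(2)])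
          (use gamma_R_function_le[OF f2 that(3)] that weight_split[of f] weight_split[of g] wt f(2) in simp)
      consider "g w = 1" | "g w = 0" "v \<noteq> w" | "g w = 0" "v = w"
        using splits_outer[OF s g(1) w] by metis
      then show "k \<in> attained G1 v"
      proof cases
        case 1
        with restrict_gamma[OF g(1)] g(2) show ?thesis by (auto simp: attained_iff)
      next
        case 2
        with RDF_dominated[OF R w_in(3)] adj_iff
        consider "\<exists>u. adj G1 w u \<and> g u = 2" | "\<exists>u. adj G2 w u \<and> g u = 2" by blast
        then show ?thesis
        proof cases
          case A: 1
          then have "RDF G1 g" using RDF_left[OF R] by blast
          with eq[OF 2(1) this flip.RDF_left_upd[OF R 2(1)]] flip.weight_left_upd[of g, OF 2(1)] g(2)
          show ?thesis by (auto simp: attained_iff)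
        next
          case B: 2
          then have "RDF G2 g" using flip.RDF_left[OF R] by blast
          with eq[OF 2(1) RDF_left_upd[OF R 2(1)]] weight_left_upd[of g, OF 2(1)]
          have "gamma_R_function G1 (g(w := 1))" by simp
          moreover have "(g(w := 1)) v = k" using 2 g by simp
          ultimately show ?thesis unfolding attained_iff by blast
        qed
      next
        case 3
        \<comment> \<open>The given \<open>g\<close> may dominate \<open>w\<close> from
          \<open>G2\<close>, so it is replaced by a minimum function \<open>h\<close> with 2 at
          \<open>d\<close>. A 1 at \<open>w\<close> beside that 2 would be wasteful, hence
          \<open>h w = 0\<close>, and \<open>w\<close> is dominated inside
          \<open>G1\<close>.\<close>
        have dG: "d \<in> verts G" "adj G w d"
          using d simple_graph_adjD[OF simple1 d(1)] verts adj_iff by auto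
        obtain h where h: "gamma_R_function G h" "h d = 2"
          using splits_inner_ex[OF s dG(1) d(2)] by blast
        note Rh = gamma_R_function_RDF[OF h(1)]
        have h0: "h w = 0"
          using outer_one_not_adj_two[OF simple h(1) dG(2)] h(2) splits_outer[OF s h(1) w] by blast
        have "weight G h = weight G f"
          using h(1) f(1) by (simp add: gamma_R_function_def)
        moreover have "RDF G1 h" using RDF_left[OF Rh] d h by blast
        ultimately have "gamma_R_function G1 h"
          using gamma_R_function_eqI[OF f1] gamma_R_function_le[OF f2 flip.RDF_left_upd[OF Rh h0]]
            flip.weight_left_upd[of h, OF h0] weight_split[of f] weight_split[of h] f(2) h0 by simp
        with h0 3 g(2) show ?thesis by (auto simp: attained_iff)
      qed
    qed
  qed
  then have eq: "\<And>v. v \<in> verts G1 \<Longrightarrow> attained G1 v = attained G v" .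
  show ?thesis
    unfolding splits_def
  proof (intro conjI ballI)
    fix v
    show "attained G1 v = {0, 1}" if "v \<in> A \<inter> verts G1"
      using that s eq[of v] by (simp add: splits_def)
    show "attained G1 v = {0, 2}" if "v \<in> verts G1 - A \<inter> verts G1"
    proof -
      have "v \<in> verts G1" "v \<notin> A" using that by auto
      with s eq[of v] show ?thesis by (simp add: splits_def verts)
    qed
  qed simp
qed

end

section \<open>Blocks\<close>

text \<open>The corona condition with the leaf set as a parameter, so that it can be compared
  directly with the set in \<open>splits\<close>. Connectedness and the number of stems are kept
  apart.\<close>

definition corona_on :: "'a graph \<Rightarrow> 'a set \<Rightarrow> bool" where
  "corona_on G A \<longleftrightarrow> A \<subseteq> verts G \<and> (\<forall>a\<in>A. \<exists>c\<in>verts G - A. nbhd G a = {c}) \<and>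
     (\<forall>c\<in>verts G - A. card (nbhd G c \<inter> A) = 2)"

lemma corona_on_stem:
  assumes "corona_on G A" "a \<in> A"
  obtains c where "c \<in> verts G" "c \<notin> A" "adj G a c" "\<And>u. adj G a u \<longleftrightarrow> u = c"
proof -
  obtain c where "c \<in> verts G - A" "nbhd G a = {c}" using assms unfolding corona_on_def by blast
  then show thesis using that unfolding nbhd_def by blast
qed

lemma corona_on_leaves:
  assumes "corona_on G A" "c \<in> verts G" "c \<notin> A"
  obtains a b where "a \<noteq> b" "nbhd G c \<inter> A = {a, b}" "a \<in> A" "b \<in> A" "adj G c a" "adj G c b"
    "\<And>u. adj G a u \<longleftrightarrow> u = c" "\<And>u. adj G b u \<longleftrightarrow> u = c"
proof -
  have "card (nbhd G c \<inter> A) = 2" using assms unfolding corona_on_def by blast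
  then obtain a b where ab: "nbhd G c \<inter> A = {a, b}" "a \<noteq> b" by (meson card_2_iff)
  then have m: "a \<in> A" "b \<in> A" "adj G c a" "adj G c b" unfolding nbhd_def by blast+
  have "adj G x u \<longleftrightarrow> u = c" if "x \<in> A" "adj G c x" for x u
    using corona_on_stem[OF assms(1) that(1)] that(2) by (metis adj_commute)
  with ab m that show thesis by blast
qed

text \<open>Every leaf has exactly one stem, so the stems together with their leaves partition the
  vertex set.\<close>

lemma weight_corona:
  assumes "simple_graph G" "corona_on G A"
  shows "weight G f = (\<Sum>c\<in>verts G - A. f c + sum f (nbhd G c \<inter> A))"
proof -
  have fin: "finite (verts G)" and sub: "A \<subseteq> verts G"
    using assms simple_graph_finite by (auto simp: corona_on_def)
  have A: "A = (\<Union>c\<in>verts G - A. nbhd G c \<inter> A)"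
  proof (intro equalityI subsetI)
    fix a assume "a \<in> A"
    with corona_on_stem[OF assms(2)] obtain c where "c \<in> verts G" "c \<notin> A" "adj G a c" by metis
    with \<open>a \<in> A\<close> show "a \<in> (\<Union>c\<in>verts G - A. nbhd G c \<inter> A)" by (auto simp: adj_commute)
  qed auto
  have "sum f A = (\<Sum>c\<in>verts G - A. sum f (nbhd G c \<inter> A))"
    by (subst (1) A, rule sum.UNION_disjoint)
      (use fin sub corona_on_stem[OF assms(2)] in \<open>auto intro: finite_subset simp: adj_commute\<close>,
       metis adj_commute)
  moreover have "weight G f = sum f (verts G - A) + sum f A"
    unfolding weight_def by (rule sum.subset_diff[OF sub fin])
  ultimately show ?thesis by (simp add: sum.distrib)
qed

text \<open>Both leaves can be dominated by \<open>c\<close> only: a leaf of value 0 forces 2 at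
  \<open>c\<close>, and otherwise the two leaves alone already cost 2.\<close>

lemma RDF_corona_group:
  assumes "corona_on G A" "RDF G f" "c \<in> verts G" "c \<notin> A"
  shows "2 \<le> f c + sum f (nbhd G c \<inter> A)"
    "f c + sum f (nbhd G c \<inter> A) = 2 \<Longrightarrow>
      (f c = 2 \<and> (\<forall>a\<in>nbhd G c \<inter> A. f a = 0)) \<or> (f c = 0 \<and> (\<forall>a\<in>nbhd G c \<inter> A. f a = 1))"
proof -
  obtain a b where ab: "a \<noteq> b" "nbhd G c \<inter> A = {a, b}" "a \<in> A" "b \<in> A"
    "\<And>u. adj G a u \<longleftrightarrow> u = c" "\<And>u. adj G b u \<longleftrightarrow> u = c"
    using corona_on_leaves[OF assms(1,3,4)] by metis
  have "a \<in> verts G" "b \<in> verts G" using ab assms(1) by (auto simp: corona_on_def)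
  then have "f a = 0 \<Longrightarrow> f c = 2" "f b = 0 \<Longrightarrow> f c = 2"
    using RDF_dominated[OF assms(2)] ab(5,6) by metis+
  then have "2 \<le> f c + (f a + f b)"
    "f c + (f a + f b) = 2 \<Longrightarrow> (f c = 2 \<and> f a = 0 \<and> f b = 0) \<or> (f c = 0 \<and> f a = 1 \<and> f b = 1)"
    by presburger+
  then show "2 \<le> f c + sum f (nbhd G c \<inter> A)"
    "f c + sum f (nbhd G c \<inter> A) = 2 \<Longrightarrow>
      (f c = 2 \<and> (\<forall>a\<in>nbhd G c \<inter> A. f a = 0)) \<or> (f c = 0 \<and> (\<forall>a\<in>nbhd G c \<inter> A. f a = 1))"
    unfolding ab(2) using ab(1) by simp_all
qed

text \<open>The minimum is 2 per stem, and each group then has one of the two tight patterns. In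
  \<open>h\<close> all stems have 2; \<open>k c\<close> switches the group of \<open>c\<close> to
  the other pattern, after which \<open>c\<close> must be dominated by a neighbouring stem. This is
  where \<open>nb\<close> enters, and where the path on three vertices fails.\<close>

lemma splits_corona:
  assumes sim: "simple_graph G" and cor: "corona_on G A"
    and nb: "\<And>c. c \<in> verts G \<Longrightarrow> c \<notin> A \<Longrightarrow> \<exists>c'. adj G c c' \<and> c' \<notin> A"
  shows "splits G A"
proof -
  have fin: "finite (verts G)" and sub: "A \<subseteq> verts G"
    using assms simple_graph_finite by (auto simp: corona_on_def)
  define grp where "grp f c = f c + sum f (nbhd G c \<inter> A)" for f :: "'a \<Rightarrow> nat" and c
  have wt: "weight G f = (\<Sum>c\<in>verts G - A. grp f c)" for f
    unfolding grp_def by (rule weight_corona[OF sim cor])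
  have low: "(\<Sum>c\<in>verts G - A. 2) \<le> weight G f" if "RDF G f" for f
    unfolding wt by (rule sum_mono) (use RDF_corona_group(1)[OF cor that] grp_def in auto)
  have gf: "gamma_R_function G f" if "RDF G f" "\<And>c. c \<in> verts G - A \<Longrightarrow> grp f c = 2" for f
  proof -
    have "weight G f = (\<Sum>c\<in>verts G - A. 2)" unfolding wt by (rule sum.cong) (use that in auto)
    with low that(1) show ?thesis by (simp add: gamma_R_function_iff)
  qed
  define h where "h v = (if v \<in> A then 0 else 2::nat)" for v
  have h: "gamma_R_function G h"
  proof (rule gf)
    show "RDF G h"
    proof (rule RDF_I[OF sim])
      fix v assume "v \<in> verts G" "h v = 0"
      then have "v \<in> A" by (auto simp: h_def split: if_splits)
      with corona_on_stem[OF cor this] show "\<exists>u. adj G v u \<and> h u = 2" by (metis h_def)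
    qed (auto simp: h_def)
    show "grp h c = 2" if "c \<in> verts G - A" for c using that by (simp add: grp_def h_def)
  qed
  define k where "k c v = (if v = c then 0 else if v \<in> A then if adj G c v then 1 else 0 else 2::nat)"
    for c v
  have k: "gamma_R_function G (k c)" if c: "c \<in> verts G" "c \<notin> A" for c
  proof (rule gf)
    show "RDF G (k c)"
    proof (rule RDF_I[OF sim])
      fix v assume v: "v \<in> verts G" "k c v = 0"
      show "\<exists>u. adj G v u \<and> k c u = 2"
      proof (cases "v = c")
        case True
        with nb[OF c] show ?thesis using simple_graph_adjD(3)[OF sim] by (force simp: k_def)
      next
        case False
        with v have "v \<in> A" "\<not> adj G c v" by (auto simp: k_def split: if_splits)
        with corona_on_stem[OF cor, of v] show ?thesis by (metis adj_commute k_def)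
      qed
    qed (auto simp: k_def)
    show "grp (k c) d = 2" if d: "d \<in> verts G - A" for d
    proof -
      obtain a b where ab: "a \<noteq> b" "nbhd G d \<inter> A = {a, b}" "a \<in> A" "b \<in> A"
        "adj G d a" "adj G d b" "\<And>u. adj G a u \<longleftrightarrow> u = d" "\<And>u. adj G b u \<longleftrightarrow> u = d"
        using corona_on_leaves[OF cor] d by (metis DiffD1 DiffD2)
      then show ?thesis using c d by (auto simp: grp_def k_def adj_commute[of G c])
    qed
  qed
  have val: "(f c = 2 \<and> (\<forall>a\<in>nbhd G c \<inter> A. f a = 0)) \<or> (f c = 0 \<and> (\<forall>a\<in>nbhd G c \<inter> A. f a = 1))"
    if f: "gamma_R_function G f" and c: "c \<in> verts G" "c \<notin> A" for f c
  proof -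
    note R = gamma_R_function_RDF[OF f]
    have ge: "2 \<le> grp f d" if "d \<in> verts G - A" for d
      using RDF_corona_group(1)[OF cor R] that by (simp add: grp_def)
    have "weight G h = (\<Sum>c\<in>verts G - A. 2)"
      unfolding wt by (rule sum.cong) (auto simp: grp_def h_def)
    then have "(\<Sum>c\<in>verts G - A. grp f c) = (\<Sum>c\<in>verts G - A. 2)"
      using gamma_R_function_le[OF f gamma_R_function_RDF[OF h]] low[OF R] wt[of f] by simp
    then have "grp f c = 2"
      using sum_mono_inv[of "\<lambda>_. 2" "verts G - A" "grp f" c] ge c fin by simp
    then show ?thesis using RDF_corona_group(2)[OF cor R c] by (simp add: grp_def)
  qed
  show ?thesis
    unfolding splits_def
  proof (intro conjI sub ballI)
    fix a assume a: "a \<in> A"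
    then obtain c where c: "c \<in> verts G" "c \<notin> A" "adj G c a"
      using corona_on_stem[OF cor] by (metis adj_commute)
    have "{0, 1} \<subseteq> attained G a"
      using h k[OF c(1,2)] a c by (force simp: attained_iff h_def k_def)
    moreover have "attained G a \<subseteq> {0, 1}"
    proof
      fix x assume "x \<in> attained G a"
      then obtain f where "gamma_R_function G f" "f a = x" by (auto simp: attained_iff)
      with val[OF this(1) c(1,2)] a c(3) show "x \<in> {0, 1}" by auto
    qed
    ultimately show "attained G a = {0, 1}" by blast
  next
    fix c assume "c \<in> verts G - A"
    then have c: "c \<in> verts G" "c \<notin> A" by auto
    have "{0, 2} \<subseteq> attained G c"
      using h k[OF c] c by (force simp: attained_iff h_def k_def)
    moreover have "attained G c \<subseteq> {0, 2}"
    proof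
      fix x assume "x \<in> attained G c"
      then obtain f where "gamma_R_function G f" "f c = x" by (auto simp: attained_iff)
      with val[OF this(1) c] show "x \<in> {0, 2}" by auto
    qed
    ultimately show "attained G c = {0, 2}" by blast
  qed
qed

text \<open>Otherwise \<open>c\<close> and its leaves would be a whole component, leaving no room
  for a second stem.\<close>

lemma corona_inner_neighbour:
  assumes "tree G" "corona_on G A" "2 \<le> card (verts G - A)" "c \<in> verts G" "c \<notin> A"
  shows "\<exists>c'. adj G c c' \<and> c' \<notin> A"
proof (rule ccontr)
  assume no: "\<not> ?thesis"
  have "verts G \<subseteq> insert c (nbhd G c \<inter> A)"
  proof (rule connected_graph_closed[of G c])
    fix x y assume "x \<in> insert c (nbhd G c \<inter> A)" "adj G x y"
    then show "y \<in> insert c (nbhd G c \<inter> A)"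
      using no corona_on_stem[OF assms(2), of x] by (metis IntE IntI adj_commute insertE insertI1 insertI2 nbhd_iff)
  qed (use assms in \<open>auto simp: tree_def\<close>)
  then have "verts G - A \<subseteq> {c}" by auto
  then have "card (verts G - A) \<le> 1" using card_mono[of "{c}"] by fastforce
  with assms(3) show False by simp
qed

section \<open>Labeled blocks and their splittings\<close>

definition outer :: "'a graph \<Rightarrow> ('a \<Rightarrow> status) \<Rightarrow> 'a set" where
  "outer G S = {v \<in> verts G. S v = StA}"

lemma leaf_iff: "simple_graph G \<Longrightarrow> leaf G v \<longleftrightarrow> v \<in> verts G \<and> card (nbhd G v) = 1"
proof -
  assume "simple_graph G"
  then have "{u \<in> verts G. adj G v u} = nbhd G v" using simple_graph_adjD(2) by (auto simp: nbhd_def)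
  then show ?thesis by (simp add: leaf_def)
qed

text \<open>The labels make leaves and stems exclusive, which turns "leaf or stem" into a partition.
  Conversely a vertex outside the set has two neighbours in it and so cannot be a leaf.\<close>

lemma labeled_corona_iff:
  "labeled_K2bar_corona_tree G S \<longleftrightarrow> tree G \<and> corona_on G (outer G S) \<and>
     2 \<le> card (verts G - outer G S) \<and> (\<forall>v\<in>verts G - outer G S. S v = StC)"
proof
  assume L: "labeled_K2bar_corona_tree G S"
  then have t: "tree G" and K: "K2bar_corona G" and two: "2 \<le> card {v. stem G v}"
    and SA: "\<And>v. leaf G v \<Longrightarrow> S v = StA" and SC: "\<And>v. stem G v \<Longrightarrow> S v = StC"
    by (auto simp: labeled_K2bar_corona_tree_def)
  note sim = tree_simple[OF t]
  have ls: "\<And>v. v \<in> verts G \<Longrightarrow> leaf G v \<or> stem G v"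
    and c2: "\<And>v. stem G v \<Longrightarrow> card {u. leaf G u \<and> adj G v u} = 2"
    using K by (auto simp: K2bar_corona_def)
  have lv: "\<And>v. leaf G v \<Longrightarrow> v \<in> verts G" "\<And>v. stem G v \<Longrightarrow> v \<in> verts G"
    by (auto simp: leaf_def stem_def)
  have out: "v \<in> outer G S \<longleftrightarrow> leaf G v" for v
    using ls[of v] lv[of v] SA[of v] SC[of v] by (auto simp: outer_def)
  have inn: "v \<in> verts G - outer G S \<longleftrightarrow> stem G v" for v
    using ls[of v] lv[of v] SA[of v] SC[of v] by (auto simp: outer_def)
  have "verts G - outer G S = {v. stem G v}" using inn by blast
  moreover have "corona_on G (outer G S)"
    unfolding corona_on_def
  proof (intro conjI ballI)
    show "outer G S \<subseteq> verts G" by (auto simp: outer_def)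
    fix a assume "a \<in> outer G S"
    then have a: "leaf G a" by (simp add: out)
    then obtain c where c: "nbhd G a = {c}" by (auto simp: leaf_iff[OF sim] card_1_singleton_iff)
    then have "adj G a c" by (metis nbhd_iff singletonI)
    then have "c \<in> verts G" "adj G c a" using simple_graph_adjD[OF sim] adj_commute by metis+
    with a have "stem G c" unfolding stem_def by blast
    with c show "\<exists>c\<in>verts G - outer G S. nbhd G a = {c}" using inn by blast
  next
    fix c assume "c \<in> verts G - outer G S"
    then have "stem G c" using inn by blast
    moreover have "nbhd G c \<inter> outer G S = {u. leaf G u \<and> adj G c u}" using out by auto
    ultimately show "card (nbhd G c \<inter> outer G S) = 2" using c2 by simp
  qed
  ultimately show "tree G \<and> corona_on G (outer G S) \<and>
     2 \<le> card (verts G - outer G S) \<and> (\<forall>v\<in>verts G - outer G S. S v = StC)"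
    using t two SC by simp
next
  assume R: "tree G \<and> corona_on G (outer G S) \<and>
     2 \<le> card (verts G - outer G S) \<and> (\<forall>v\<in>verts G - outer G S. S v = StC)"
  then have t: "tree G" and cor: "corona_on G (outer G S)" by auto
  note sim = tree_simple[OF t]
  have out: "leaf G v \<longleftrightarrow> v \<in> outer G S" for v
  proof
    assume v: "leaf G v"
    show "v \<in> outer G S"
    proof (rule ccontr)
      assume "v \<notin> outer G S"
      with v cor have "card (nbhd G v \<inter> outer G S) = 2" by (auto simp: corona_on_def leaf_def)
      moreover have "card (nbhd G v \<inter> outer G S) \<le> card (nbhd G v)"
        by (intro card_mono nbhd_finite sim) auto
      ultimately show False using v by (simp add: leaf_iff[OF sim])
    qed
  next
    assume "v \<in> outer G S"
    then show "leaf G v" using cor by (auto simp: leaf_iff[OF sim] corona_on_def)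
  qed
  have leaves: "{u. leaf G u \<and> adj G v u} = nbhd G v \<inter> outer G S" for v using out by auto
  have inn: "stem G v \<longleftrightarrow> v \<in> verts G - outer G S" for v
  proof
    assume "stem G v"
    then obtain u where "leaf G u" "adj G u v" by (auto simp: stem_def adj_commute)
    with corona_on_stem[OF cor] show "v \<in> verts G - outer G S" unfolding out by (metis DiffI)
  next
    assume v: "v \<in> verts G - outer G S"
    then obtain a where "a \<in> outer G S" "adj G v a" using corona_on_leaves[OF cor] by (metis DiffD1 DiffD2)
    then show "stem G v" using v unfolding stem_def out by (metis DiffD1)
  qed
  have "card (nbhd G v \<inter> outer G S) = 2" if "v \<in> verts G - outer G S" for v
    using cor that by (simp add: corona_on_def)
  moreover have stems: "{v. stem G v} = verts G - outer G S" using inn by blast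
  moreover have "outer G S \<subseteq> {v. S v = StA}" by (auto simp: outer_def)
  ultimately show "labeled_K2bar_corona_tree G S"
    unfolding labeled_K2bar_corona_tree_def K2bar_corona_def leaves stems
    using R sim by (intro conjI) (simp_all add: inn out, auto)
qed

lemma splits_labeled_corona: "labeled_K2bar_corona_tree G S \<Longrightarrow> splits G (outer G S)"
  unfolding labeled_corona_iff using splits_corona tree_simple corona_inner_neighbour by metis

lemma is_H2_E:
  assumes "is_H2 G S"
  obtains a b c d where "distinct [a, b, c, d]" "verts G = {a, b, c, d}"
    "\<And>u. adj G a u \<longleftrightarrow> u = b" "\<And>u. adj G b u \<longleftrightarrow> u = a \<or> u = c"
    "\<And>u. adj G c u \<longleftrightarrow> u = b \<or> u = d" "\<And>u. adj G d u \<longleftrightarrow> u = c"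
    "outer G S = {a, d}" "simple_graph G" "S a = StA" "S b = StB" "S c = StB" "S d = StA"
proof -
  obtain a b c d where H: "distinct [a, b, c, d]" "verts G = {a, b, c, d}"
    "edges G = {{a, b}, {b, c}, {c, d}}" "S a = StA" "S b = StB" "S c = StB" "S d = StA"
    using assms by (auto simp: is_H2_def)
  have "simple_graph G"
    unfolding simple_graph_def H(2,3) using H(1) by auto
  moreover have "outer G S = {a, d}" using H by (auto simp: outer_def)
  ultimately show thesis using H by (intro that[of a b c d]) (auto simp: adj_def doubleton_eq_iff)
qed

text \<open>The path has just two minimum functions, 0, 2, 0, 1 and its mirror image 1, 0, 2, 0,
  both of weight 3.\<close>

lemma splits_H2:
  assumes "is_H2 G S"
  shows "splits G (outer G S)"
proof -
  obtain a b c d where dis: "distinct [a, b, c, d]" and V: "verts G = {a, b, c, d}"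
    and adj: "\<And>u. adj G a u \<longleftrightarrow> u = b" "\<And>u. adj G b u \<longleftrightarrow> u = a \<or> u = c"
      "\<And>u. adj G c u \<longleftrightarrow> u = b \<or> u = d" "\<And>u. adj G d u \<longleftrightarrow> u = c"
    and out: "outer G S = {a, d}" and sim: "simple_graph G"
    using is_H2_E[OF assms] by metis
  have wt: "weight G f = f a + f b + f c + f d" for f using dis by (simp add: weight_def V)
  have low: "3 \<le> weight G f"
    and eq: "weight G f = 3 \<Longrightarrow> (f a = 0 \<and> f b = 2 \<and> f c = 0 \<and> f d = 1) \<or> (f a = 1 \<and> f b = 0 \<and> f c = 2 \<and> f d = 0)"
    if R: "RDF G f" for f
  proof -
    have "f a = 0 \<Longrightarrow> f b = 2" "f d = 0 \<Longrightarrow> f c = 2"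
      "f b = 0 \<Longrightarrow> f a = 2 \<or> f c = 2" "f c = 0 \<Longrightarrow> f b = 2 \<or> f d = 2"
      using RDF_dominated[OF R, of a] RDF_dominated[OF R, of b] RDF_dominated[OF R, of c]
        RDF_dominated[OF R, of d] by (auto simp: V adj)
    then show "3 \<le> weight G f"
      "weight G f = 3 \<Longrightarrow> (f a = 0 \<and> f b = 2 \<and> f c = 0 \<and> f d = 1) \<or> (f a = 1 \<and> f b = 0 \<and> f c = 2 \<and> f d = 0)"
      unfolding wt by presburger+
  qed
  define f where "f = (\<lambda>v. if v = b then 2 else if v = d then 1 else 0 :: nat)"
  define g where "g = (\<lambda>v. if v = c then 2 else if v = a then 1 else 0 :: nat)"
  have "RDF G f"
    by (rule RDF_I[OF sim]) (use dis in \<open>auto simp: V adj f_def intro!: exI[of _ b]\<close>)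
  moreover have "RDF G g"
    by (rule RDF_I[OF sim]) (use dis in \<open>auto simp: V adj g_def intro!: exI[of _ c]\<close>)
  moreover have "weight G f = 3" "weight G g = 3" using dis by (auto simp: wt f_def g_def)
  ultimately have fg: "gamma_R_function G f" "gamma_R_function G g"
    using low by (auto simp: gamma_R_function_iff)
  have val: "(h a = 0 \<and> h b = 2 \<and> h c = 0 \<and> h d = 1) \<or> (h a = 1 \<and> h b = 0 \<and> h c = 2 \<and> h d = 0)"
    if "gamma_R_function G h" for h
    using that fg(1) \<open>weight G f = 3\<close> eq[of h] by (simp add: gamma_R_function_def)
  have "attained G a = {0, 1}" "attained G c = {0, 2}"
    by (rule attained_eqI[OF fg(1) _ fg(2)]; use dis val in \<open>force simp: f_def g_def\<close>)+
  moreover have "attained G b = {0, 2}" "attained G d = {0, 1}"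
    by (rule attained_eqI[OF fg(2) _ fg(1)]; use dis val in \<open>force simp: f_def g_def\<close>)+
  ultimately show ?thesis using dis unfolding splits_def out V by auto
qed

section \<open>The second family\<close>

definition block :: "'a graph \<Rightarrow> ('a \<Rightarrow> status) \<Rightarrow> bool" where
  "block K I \<longleftrightarrow> is_H2 K I \<or> labeled_K2bar_corona_tree K I"

lemma T'_step: "T'_01_02 G' S' \<Longrightarrow> block K I \<Longrightarrow> identify_at_A G' S' K I G S \<Longrightarrow> T'_01_02 G S"
  unfolding block_def using T'_01_02.step_op7 T'_01_02.step_op8 by (metis op7_def op8_def)

text \<open>The starting graphs and the attached graphs are of the same two kinds, so the four rules
  collapse into two cases.\<close>

lemma T'_block_induct [consumes 1, case_names block step]:
  assumes "T'_01_02 G S"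
    and "\<And>G S. block G S \<Longrightarrow> P G S"
    and "\<And>G' S' K I G S. T'_01_02 G' S' \<Longrightarrow> P G' S' \<Longrightarrow> block K I \<Longrightarrow> identify_at_A G' S' K I G S \<Longrightarrow> P G S"
  shows "P G S"
  using assms(1)
proof induction
  case (step_op7 G' S' G S)
  then show ?case using assms(3) unfolding op7_def block_def by metis
next
  case (step_op8 G' S' G S)
  then show ?case using assms(3) unfolding op8_def block_def by metis
qed (use assms(2) in \<open>auto simp: block_def\<close>)

lemma block_simple: "block K I \<Longrightarrow> simple_graph K"
  unfolding block_def labeled_corona_iff using tree_simple by (auto elim: is_H2_E)

lemma block_splits: "block K I \<Longrightarrow> splits K (outer K I)"
  unfolding block_def using splits_H2 splits_labeled_corona by blast

lemma block_inner: "block K I \<Longrightarrow> verts K - outer K I \<noteq> {}"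
proof -
  assume "block K I"
  then consider "is_H2 K I" | "2 \<le> card (verts K - outer K I)"
    unfolding block_def labeled_corona_iff by blast
  then show ?thesis
  proof cases
    case 1
    then show ?thesis by (auto simp: is_H2_def outer_def)
  next
    case 2
    then show ?thesis by (metis card.empty not_numeral_le_zero)
  qed
qed

lemma identify_at_A_I:
  assumes "verts G' \<inter> verts H = {w}" "S' w = StA" "I w = StA"
    and "verts G = verts G' \<union> verts H" "edges G = edges G' \<union> edges H"
    and "\<And>v. v \<in> verts G' \<Longrightarrow> S v = S' v" "\<And>v. v \<in> verts H \<Longrightarrow> S v = I v"
  shows "identify_at_A G' S' H I G S"
  using assms unfolding identify_at_A_def statuses_kept_def by blast

lemma identify_gluing:
  assumes "simple_graph G'" "simple_graph H" "identify_at_A G' S' H I G S"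
  obtains w where "gluing G' H G w" "w \<in> outer G' S'" "w \<in> outer H I"
    "outer G S = outer G' S' \<union> outer H I"
proof -
  obtain w where w: "verts G' \<inter> verts H = {w}" "S' w = StA" "I w = StA"
    using assms(3) unfolding identify_at_A_def by blast
  have rest: "verts G = verts G' \<union> verts H" "edges G = edges G' \<union> edges H"
    "\<And>v. v \<in> verts G' \<Longrightarrow> S v = S' v" "\<And>v. v \<in> verts H \<Longrightarrow> S v = I v"
    using assms(3) by (auto simp: identify_at_A_def statuses_kept_def)
  have "gluing G' H G w" using assms w rest by unfold_locales auto
  moreover have "w \<in> outer G' S'" "w \<in> outer H I" using w by (auto simp: outer_def)
  moreover have "outer G S = outer G' S' \<union> outer H I" using rest by (auto simp: outer_def)
  ultimately show thesis using that by blast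
qed

lemma T'_splits:
  assumes "T'_01_02 G S"
  shows "simple_graph G \<and> splits G (outer G S) \<and> outer G S \<noteq> {} \<and> verts G - outer G S \<noteq> {}"
  using assms
proof (induction rule: T'_block_induct)
  case (block G S)
  have "outer G S \<noteq> {}"
  proof (cases "is_H2 G S")
    case True
    then show ?thesis by (auto simp: is_H2_def outer_def)
  next
    case False
    with block have "corona_on G (outer G S)" by (simp add: block_def labeled_corona_iff)
    moreover obtain c where "c \<in> verts G" "c \<notin> outer G S" using block_inner[OF block] by blast
    ultimately show ?thesis using corona_on_leaves by (metis Diff_iff empty_iff)
  qed
  with block show ?case using block_simple block_splits block_inner by metis
next
  case (step G' S' K I G S)
  then obtain w where w: "gluing G' K G w" "w \<in> outer G' S'" "w \<in> outer K I"
    "outer G S = outer G' S' \<union> outer K I"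
    using identify_gluing block_simple by metis
  interpret gluing G' K G w by (rule w)
  have "splits G (outer G S)"
    unfolding w(4) using splits_glue step block_splits w by blast
  \<comment> \<open>A vertex of \<open>G'\<close> that is outer in \<open>K\<close> must be
    \<open>w\<close>, which is already outer in \<open>G'\<close>; so inner vertices of
    \<open>G'\<close> stay inner.\<close>
  moreover have "outer K I \<inter> verts G' \<subseteq> {w}" using inter by (auto simp: outer_def)
  then have "verts G' - outer G' S' \<subseteq> verts G - outer G S" using w verts by auto
  ultimately show ?case using simple step w by blast
qed

text \<open>The rules attach a single block, while cutting a tree yields two arbitrary members. If
  \<open>H\<close> is \<open>H'\<close> with a block \<open>K\<close> attached, then whichever of
  the two contains \<open>w\<close> is attached first and the other one afterwards at
  \<open>u\<close>.\<close>

lemma T'_glue: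
  assumes "T'_01_02 H L" "T'_01_02 G' S'" "identify_at_A G' S' H L G S"
  shows "T'_01_02 G S"
  using assms
proof (induction arbitrary: G' S' G S rule: T'_block_induct)
  case (block H L)
  then show ?case using T'_step by blast
next
  case (step H' L' K I H L)
  obtain u where u: "verts H' \<inter> verts K = {u}" "L' u = StA" "I u = StA"
    using step.hyps(3) unfolding identify_at_A_def by blast
  obtain w where w: "verts G' \<inter> verts H = {w}" "S' w = StA" "L w = StA"
    using step.prems(2) unfolding identify_at_A_def by blast
  have H: "verts H = verts H' \<union> verts K" "edges H = edges H' \<union> edges K"
    "\<And>v. v \<in> verts H' \<Longrightarrow> L v = L' v" "\<And>v. v \<in> verts K \<Longrightarrow> L v = I v"
    using step.hyps(3) by (auto simp: identify_at_A_def statuses_kept_def)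
  have G: "verts G = verts G' \<union> verts H" "edges G = edges G' \<union> edges H"
    "\<And>v. v \<in> verts G' \<Longrightarrow> S v = S' v" "\<And>v. v \<in> verts H \<Longrightarrow> S v = L v"
    using step.prems(2) by (auto simp: identify_at_A_def statuses_kept_def)
  have SH': "S v = L' v" if "v \<in> verts H'" for v using that G(4)[of v] H(1) H(3)[of v] by simp
  have SK: "S v = I v" if "v \<in> verts K" for v using that G(4)[of v] H(1) H(4)[of v] by simp
  have V: "verts G = verts G' \<union> (verts H' \<union> verts K)" "edges G = edges G' \<union> (edges H' \<union> edges K)"
    using G(1,2) H(1,2) by simp_all
  show ?case
  proof (cases "w \<in> verts H'")
    case True
    define M where "M = \<lparr>verts = verts G' \<union> verts H', edges = edges G' \<union> edges H'\<rparr>"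
    have i: "verts G' \<inter> verts H' = {w}" using True w H by blast
    have "L' w = StA" using H(3)[OF True] w by simp
    then have "identify_at_A G' S' H' L' M S"
      by (intro identify_at_A_I[OF i]) (simp_all add: M_def w(2) G(3) SH' SK)
    then have M: "T'_01_02 M S" using step by blast
    have "(verts G' \<union> verts H') \<inter> verts K = {u}" using i u w H by blast
    moreover have "u \<in> verts H'" using u by blast
    then have "S u = StA" using u(2) SH' by simp
    ultimately have "identify_at_A M S K I G S"
      by (intro identify_at_A_I[of M K u]) (auto simp: M_def u(3) V G(3) SH' SK)
    then show ?thesis using T'_step M step by blast
  next
    case False
    define M where "M = \<lparr>verts = verts G' \<union> verts K, edges = edges G' \<union> edges K\<rparr>"
    have wK: "w \<in> verts K" using False w H by blast
    have i: "verts G' \<inter> verts K = {w}" using wK w H by blast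
    have "I w = StA" using H(4)[OF wK] w(3) by metis
    then have "identify_at_A G' S' K I M S"
      by (intro identify_at_A_I[OF i]) (simp_all add: M_def w(2) G(3) SH' SK)
    then have M: "T'_01_02 M S" using T'_step step by blast
    have "verts G' \<inter> verts H' \<subseteq> {w}" using w(1) H(1) by blast
    then have "verts G' \<inter> verts H' = {}" using False by blast
    then have "(verts G' \<union> verts K) \<inter> verts H' = {u}" using u(1) by (simp add: Int_Un_distrib2 Int_commute[of "verts K"])
    moreover have "u \<in> verts H'" using u by blast
    then have "S u = StA" using u(2) SH' by simp
    ultimately have "identify_at_A M S H' L' G S"
      by (intro identify_at_A_I[of M H' u]) (auto simp: M_def u(2) V G(3) SH' SK)
    then show ?thesis using M step by blast
  qed
qed

text \<open>The new leaves have one neighbour each and lie on no cycle; this leaves the new stem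
  only \<open>u\<close>, so it lies on none either. As \<open>u\<close> has status C, the new edge
  joins two stems and the leaves at each old stem are unchanged.\<close>

lemma corona_extend:
  assumes cor: "labeled_K2bar_corona_tree K I" and op: "op5 K I G S"
  shows "labeled_K2bar_corona_tree G S"
proof -
  from op obtain F J u x where F: "is_F1 x F J" and dis: "verts K \<inter> verts F = {}"
    and u: "u \<in> verts K" "I u = StC"
    and V: "verts G = verts K \<union> verts F" and E: "edges G = edges K \<union> edges F \<union> {{u, x}}"
    and S: "\<And>v. v \<in> verts K \<Longrightarrow> S v = I v" "\<And>v. v \<in> verts F \<Longrightarrow> S v = J v"
    by (auto simp: op5_def statuses_kept_def)
  from F obtain a b where ab: "distinct [a, x, b]" "verts F = {a, x, b}"
    "edges F = {{a, x}, {x, b}}" "J a = StA" "J x = StC" "J b = StA"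
    by (auto simp: is_F1_def)
  have K: "tree K" "corona_on K (outer K I)" "2 \<le> card (verts K - outer K I)"
    "\<And>v. v \<in> verts K - outer K I \<Longrightarrow> I v = StC"
    using cor by (auto simp: labeled_corona_iff)
  note sK = tree_simple[OF K(1)]
  have new: "a \<notin> verts K" "x \<notin> verts K" "b \<notin> verts K" using dis ab by auto
  have adj: "adj G v y \<longleftrightarrow> adj K v y \<or> {v, y} = {a, x} \<or> {v, y} = {x, b} \<or> {v, y} = {u, x}" for v y
    by (simp add: adj_def E ab disj_commute disj_left_commute)
  have adjK: "adj K v y \<Longrightarrow> v \<in> verts K \<and> y \<in> verts K" for v y
    using simple_graph_adjD[OF sK] by blast
  have adj_a: "adj G a y \<longleftrightarrow> y = x" and adj_b: "adj G b y \<longleftrightarrow> y = x"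
    and adj_x: "adj G x y \<longleftrightarrow> y = a \<or> y = b \<or> y = u" for y
    using adjK new ab(1) u unfolding adj by (auto simp: doubleton_eq_iff)
  have adj_K: "adj G v y \<longleftrightarrow> adj K v y \<or> v = u \<and> y = x" if "v \<in> verts K" for v y
    using that new unfolding adj by (auto simp: doubleton_eq_iff)
  have sG: "simple_graph G"
    using sK ab u new unfolding simple_graph_def V E by (auto simp: ab) blast+
  have out: "outer G S = outer K I \<union> {a, b}"
    using S ab by (auto simp: outer_def V)
  have inn: "verts G - outer G S = insert x (verts K - outer K I)"
    using out new ab S(2)[of x] by (auto simp: V outer_def)
  have "connected_graph G"
  proof (rule connected_graphI)
    fix v assume "v \<in> verts G"
    have K_reach: "(adj G)\<^sup>*\<^sup>* v u" if "v \<in> verts K" for v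
    proof -
      have "(adj K)\<^sup>*\<^sup>* v u" using K(1) u that by (auto simp: tree_def connected_graph_def)
      then show ?thesis by (rule rtranclp_mono[THEN predicate2D, rotated]) (auto simp: adj)
    qed
    have x: "(adj G)\<^sup>*\<^sup>* x u" using adj_x by blast
    moreover have "(adj G)\<^sup>*\<^sup>* a u" "(adj G)\<^sup>*\<^sup>* b u"
      using adj_a[of x] adj_b[of x] x by (auto intro: converse_rtranclp_into_rtranclp[of "adj G" _ x u])
    ultimately show "(adj G)\<^sup>*\<^sup>* v u" using \<open>v \<in> verts G\<close> K_reach by (auto simp: V ab)
  qed
  moreover have "\<nexists>p. is_cycle G p"
  proof
    assume "\<exists>p. is_cycle G p"
    then obtain p where p: "is_cycle G p" ..
    have "a \<notin> set p" "b \<notin> set p"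
      using cycle_two_neighbours[OF p] adj_a adj_b by metis+
    then have "x \<notin> set p" using cycle_two_neighbours[OF p] adj_x by metis
    with \<open>a \<notin> set p\<close> \<open>b \<notin> set p\<close> p have sub: "set p \<subseteq> verts K"
      by (auto simp: is_cycle_def V ab)
    have ad: "adj K v y" if "v \<in> set p" "y \<in> set p" "adj G v y" for v y
      using that adj_K[of v y] sub \<open>x \<notin> set p\<close> by blast
    have "p \<noteq> []" using p by (auto simp: is_cycle_def)
    with p sub ad have "is_cycle K p"
      unfolding is_cycle_def by (auto intro: successively_mono)
    with K(1) show False by (auto simp: tree_def)
  qed
  ultimately have "tree G" using sG by (simp add: tree_def)
  moreover have "corona_on G (outer G S)"
    unfolding corona_on_def
  proof (intro conjI ballI)
    show "outer G S \<subseteq> verts G" by (auto simp: outer_def)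
  next
    fix v assume v: "v \<in> outer G S"
    show "\<exists>c\<in>verts G - outer G S. nbhd G v = {c}"
    proof (cases "v \<in> outer K I")
      case True
      then have vK: "v \<in> verts K" "v \<noteq> u" using u by (auto simp: outer_def)
      from True K(2) obtain c where c: "c \<in> verts K - outer K I" "nbhd K v = {c}"
        unfolding corona_on_def by blast
      have "nbhd G v = nbhd K v" using adj_K[OF vK(1)] vK(2) by (auto simp: nbhd_def)
      with c show ?thesis unfolding inn by blast
    next
      case False
      with v out have "v = a \<or> v = b" by auto
      then have "nbhd G v = {x}" using adj_a adj_b by (auto simp: nbhd_def)
      then show ?thesis unfolding inn by blast
    qed
  next
    fix c assume "c \<in> verts G - outer G S"
    then consider "c = x" | "c \<in> verts K - outer K I" unfolding inn by blast
    then show "card (nbhd G c \<inter> outer G S) = 2"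
    proof cases
      case 1
      have "u \<notin> outer G S" using u S(1)[of u] by (auto simp: outer_def)
      then have "nbhd G c \<inter> outer G S = {a, b}" using 1 adj_x out by (auto simp: nbhd_def)
      then show ?thesis using ab(1) by auto
    next
      case 2
      have "x \<notin> outer G S" using inn by blast
      then have "nbhd G c \<inter> outer G S = nbhd K c \<inter> outer K I"
        using 2 adj_K[of c] adjK new by (auto simp: out)
      with 2 K(2) show ?thesis by (simp add: corona_on_def)
    qed
  qed
  moreover have "2 \<le> card (verts G - outer G S)"
    unfolding inn using K(3) new simple_graph_finite[OF sK] by (simp add: card_insert_if)
  moreover have "\<forall>v\<in>verts G - outer G S. S v = StC"
    unfolding inn using K(4) S ab by auto
  ultimately show ?thesis unfolding labeled_corona_iff by blast
qed

text \<open>A path on four vertices offers no vertex of status C, so in a single block the operation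
  meets a corona. In a glued graph it is carried out first in the part containing \<open>u\<close>;
  gluing follows, since an enlarged corona is still a block.\<close>

lemma T'_op5:
  assumes "T'_01_02 G' S'" "op5 G' S' G S"
  shows "T'_01_02 G S"
  using assms
proof (induction arbitrary: G S rule: T'_block_induct)
  case (block G' S')
  show ?case
  proof (cases "is_H2 G' S'")
    case True
    with block(2) show ?thesis by (auto simp: is_H2_def op5_def)
  next
    case False
    with block show ?thesis
      unfolding block_def using corona_extend T'_01_02.start_corona by metis
  qed
next
  case (step H L K I G' S')
  obtain w where w: "verts H \<inter> verts K = {w}" "L w = StA" "I w = StA"
    using step.hyps(3) unfolding identify_at_A_def by blast
  have G': "verts G' = verts H \<union> verts K" "edges G' = edges H \<union> edges K"
    "\<And>v. v \<in> verts H \<Longrightarrow> S' v = L v" "\<And>v. v \<in> verts K \<Longrightarrow> S' v = I v"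
    using step.hyps(3) by (auto simp: identify_at_A_def statuses_kept_def)
  from step.prems(1) obtain F J u x where F: "is_F1 x F J" and dis: "verts G' \<inter> verts F = {}"
    and u: "u \<in> verts G'" "S' u = StC"
    and V: "verts G = verts G' \<union> verts F" and E: "edges G = edges G' \<union> edges F \<union> {{u, x}}"
    and S: "\<And>v. v \<in> verts G' \<Longrightarrow> S v = S' v" "\<And>v. v \<in> verts F \<Longrightarrow> S v = J v"
    by (auto simp: op5_def statuses_kept_def)
  have "w \<in> verts H" using w by blast
  then have Sw: "S w = StA" using w(2) S(1)[of w] G'(1) G'(3)[of w] by simp
  show ?case
  proof (cases "u \<in> verts H")
    case True
    define M where "M = \<lparr>verts = verts H \<union> verts F, edges = edges H \<union> edges F \<union> {{u, x}}\<rparr>"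
    have "op5 H L M S"
      unfolding op5_def statuses_kept_def
      by (rule exI[of _ F], rule exI[of _ J], rule exI[of _ u], rule exI[of _ x])
        (use F dis u S G' True in \<open>auto simp: M_def\<close>)
    then have M: "T'_01_02 M S" using step by blast
    have "verts M \<inter> verts K = {w}" using w dis G' by (auto simp: M_def)
    then have "identify_at_A M S K I G S"
      unfolding identify_at_A_def statuses_kept_def
      using w S V E G' Sw by (intro conjI exI[of _ w]) (auto simp: M_def)
    then show ?thesis using T'_step M step by blast
  next
    case False
    then have uK: "u \<in> verts K" "I u = StC" using u G' by auto
    define M where "M = \<lparr>verts = verts K \<union> verts F, edges = edges K \<union> edges F \<union> {{u, x}}\<rparr>"
    have "op5 K I M S"
      unfolding op5_def statuses_kept_def
      by (rule exI[of _ F], rule exI[of _ J], rule exI[of _ u], rule exI[of _ x])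
        (use F dis u S G' uK in \<open>auto simp: M_def\<close>)
    moreover have "\<not> is_H2 K I" using uK by (auto simp: is_H2_def)
    ultimately have "block M S" using step.hyps(2) corona_extend by (auto simp: block_def)
    moreover have "verts H \<inter> verts M = {w}" using w dis G' by (auto simp: M_def)
    then have "identify_at_A H L M S G S"
      unfolding identify_at_A_def statuses_kept_def
      using w S V E G' Sw by (intro conjI exI[of _ w]) (auto simp: M_def)
    ultimately show ?thesis using T'_step step by blast
  qed
qed

section \<open>Comparison of the two families\<close>

text \<open>An end vertex of the tree of stems is removed with its two leaves. It can be chosen
  different from a prescribed stem \<open>c\<close>, which matters when the corona is attached to
  another graph near \<open>c\<close>.\<close>

lemma corona_peel:
  assumes cor: "labeled_K2bar_corona_tree G S" and c: "c \<in> verts G - outer G S"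
  shows "is_H3 G S \<or>
    (\<exists>G'. labeled_K2bar_corona_tree G' S \<and> op5 G' S G S \<and> c \<in> verts G' - outer G' S)"
proof -
  define A where "A = outer G S"
  have G: "tree G" "corona_on G A" "2 \<le> card (verts G - A)"
    and SC: "\<forall>v\<in>verts G - A. S v = StC"
    using cor unfolding labeled_corona_iff A_def by simp_all
  have SA: "S v = StA" if "v \<in> A" for v using that by (simp add: A_def outer_def)
  note sim = tree_simple[OF G(1)]
  note c = c[folded A_def]
  obtain c' where c': "adj G c c'" "c' \<notin> A"
    using corona_inner_neighbour[OF G(1-3)] c by blast
  have "c' \<in> verts G - A" using c' simple_graph_adjD[OF sim] by blast
  then obtain x u where x: "x \<in> verts G - A" "x \<noteq> c" and xu: "nbhd G x \<inter> (verts G - A) = {u}"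
    using tree_end_vertex[OF G(1) _ c _ c'(1)] by blast
  have u: "adj G x u" "u \<in> verts G" "u \<notin> A" "u \<noteq> x"
    using xu simple_graph_adjD(3)[OF sim] by (auto simp: nbhd_def)
  obtain a b where ab: "a \<noteq> b" "nbhd G x \<inter> A = {a, b}" "a \<in> A" "b \<in> A" "adj G x a" "adj G x b"
    and adj_a: "\<And>y. adj G a y \<longleftrightarrow> y = x" and adj_b: "\<And>y. adj G b y \<longleftrightarrow> y = x"
    using corona_on_leaves[OF G(2)] x(1) by (metis DiffD1 DiffD2)
  have abV: "a \<in> verts G" "b \<in> verts G" using ab G(2) by (auto simp: corona_on_def)
  have adj_x: "adj G x y \<longleftrightarrow> y = a \<or> y = b \<or> y = u" for y
  proof -
    have "adj G x y \<longleftrightarrow> y \<in> nbhd G x \<inter> A \<or> y \<in> nbhd G x \<inter> (verts G - A)"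
      using simple_graph_adjD(2)[OF sim] by auto
    then show ?thesis unfolding xu ab(2) by auto
  qed
  let ?X = "{x, a, b}"
  have dis: "distinct [a, x, b]" "u \<notin> ?X" using ab x(1) u by auto
  show ?thesis
  proof (cases "card (verts G - A) = 2")
    \<comment> \<open>With two stems, peeling would leave a corona too small to be a block; this is
      the base case.\<close>
    case True
    then have C: "verts G - A = {x, u}"
      using x(1) u card_seteq[of "verts G - A" "{x, u}"] simple_graph_finite[OF sim] by auto
    obtain d e where de: "d \<noteq> e" "nbhd G u \<inter> A = {d, e}" "d \<in> A" "e \<in> A" "adj G u d" "adj G u e"
      "\<And>y. adj G d y \<longleftrightarrow> y = u" "\<And>y. adj G e y \<longleftrightarrow> y = u"
      using corona_on_leaves[OF G(2) u(2,3)] by metis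
    have deV: "d \<in> verts G" "e \<in> verts G" using de G(2) by (auto simp: corona_on_def)
    have A: "A \<subseteq> {a, b, d, e}"
    proof
      fix v assume v: "v \<in> A"
      then obtain w where "w \<in> verts G - A" "adj G w v"
        using corona_on_stem[OF G(2)] by (metis Diff_iff adj_commute)
      then have "v \<in> nbhd G x \<inter> A \<or> v \<in> nbhd G u \<inter> A" using v unfolding C by auto
      then show "v \<in> {a, b, d, e}" unfolding ab(2) de(2) by blast
    qed
    have "distinct [x, u, a, b, d, e]"
      using ab de u x(1) adj_a adj_b by (auto simp: distinct_length_2_or_more)
    moreover have V: "verts G = {x, u, a, b, d, e}" using A C abV deV x(1) u by blast
    moreover have "edges G = {{x, u}, {x, a}, {x, b}, {u, d}, {u, e}}"
    proof
      show "{{x, u}, {x, a}, {x, b}, {u, d}, {u, e}} \<subseteq> edges G"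
        using u ab de unfolding adj_def by blast
      have adj_u: "adj G u y \<Longrightarrow> y = x \<or> y = d \<or> y = e" for y
      proof -
        assume y: "adj G u y"
        then have "y \<in> nbhd G u \<inter> A \<or> y \<in> verts G - A" "y \<noteq> u" using simple_graph_adjD[OF sim y] by auto
        then show ?thesis unfolding C de(2) by blast
      qed
      show "edges G \<subseteq> {{x, u}, {x, a}, {x, b}, {u, d}, {u, e}}"
      proof
        fix f assume "f \<in> edges G"
        then obtain p q where pq: "f = {p, q}" "adj G p q" using simple_graph_edge[OF sim] by metis
        have "p = x \<or> p = u \<or> p = a \<or> p = b \<or> p = d \<or> p = e"
          using simple_graph_adjD(1)[OF sim pq(2)] unfolding V by simp
        then show "f \<in> {{x, u}, {x, a}, {x, b}, {u, d}, {u, e}}"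
        proof (elim disjE)
          assume "p = u"
          with adj_u[of q] pq show ?thesis by (auto simp: insert_commute)
        qed (use pq adj_x adj_a adj_b de(7,8) in \<open>auto simp: insert_commute\<close>)
      qed
    qed
    moreover have "S x = StC" "S u = StC" "S a = StA" "S b = StA" "S d = StA" "S e = StA"
      using SC x(1) u SA ab de by auto
    ultimately have "is_H3 G S" unfolding is_H3_def by blast
    then show ?thesis ..
  next
    case False
    define G' where "G' = induced G (verts G - ?X)"
    have VG': "verts G' = verts G - ?X" and adj': "adj G' p q \<longleftrightarrow> adj G p q \<and> p \<in> verts G - ?X \<and> q \<in> verts G - ?X" for p q
      by (simp_all add: G'_def)
    have t': "tree G'"
      unfolding G'_def using adj_x adj_a adj_b dis u by (intro tree_delete[OF G(1), of u]) auto
    have out': "outer G' S = A - {a, b}" using x(1) by (auto simp: outer_def A_def VG')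
    have inn': "verts G' - outer G' S = verts G - A - {x}" using x(1) ab by (auto simp: VG' out')
    have cor': "corona_on G' (outer G' S)"
      unfolding corona_on_def
    proof (intro conjI ballI)
      show "outer G' S \<subseteq> verts G'" by (auto simp: outer_def)
      fix v assume v: "v \<in> outer G' S"
      then have vA: "v \<in> A" "v \<in> verts G - ?X" using out' by (auto simp: outer_def VG')
      then obtain w where w: "w \<in> verts G" "w \<notin> A" "\<And>y. adj G v y \<longleftrightarrow> y = w"
        using corona_on_stem[OF G(2)] by metis
      have "w \<noteq> x" using w(3)[of x] adj_x[of v] vA u by (auto simp: adj_commute)
      then have "w \<in> verts G - ?X" using w ab by auto
      then have "nbhd G' v = {w}" using w(3) vA by (auto simp: nbhd_def adj')
      with \<open>w \<noteq> x\<close> w show "\<exists>c\<in>verts G' - outer G' S. nbhd G' v = {c}" unfolding inn' by blast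
    next
      fix v assume "v \<in> verts G' - outer G' S"
      then have v: "v \<in> verts G" "v \<notin> A" "v \<noteq> x" unfolding inn' by auto
      then have "v \<in> verts G - ?X" using ab by auto
      then have "nbhd G' v \<inter> outer G' S = nbhd G v \<inter> A"
        using v adj_a[of v] adj_b[of v] x(1) G(2) by (auto simp: adj' out' adj_commute corona_on_def)
      then show "card (nbhd G' v \<inter> outer G' S) = 2" using G(2) v by (simp add: corona_on_def)
    qed
    have "2 \<le> card (verts G' - outer G' S)"
      unfolding inn' using False G(3) x(1) simple_graph_finite[OF sim] by (simp add: card_Diff_singleton)
    then have "labeled_K2bar_corona_tree G' S"
      unfolding labeled_corona_iff using t' cor' SC inn' by auto
    moreover have "op5 G' S G S"
    proof -
      define F where "F = \<lparr>verts = {a, x, b}, edges = {{a, x}, {x, b}}\<rparr>"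
      have "is_F1 x F S" using dis SC x(1) SA ab unfolding is_F1_def F_def by (intro exI[of _ a] exI[of _ b]) auto
      moreover have "edges G = edges G' \<union> edges F \<union> {{u, x}}"
      proof
        show "edges G' \<union> edges F \<union> {{u, x}} \<subseteq> edges G"
          using u ab by (auto simp: G'_def F_def adj_def insert_commute)
        show "edges G \<subseteq> edges G' \<union> edges F \<union> {{u, x}}"
        proof
          fix f assume "f \<in> edges G"
          then obtain p q where pq: "f = {p, q}" "adj G p q" using simple_graph_edge[OF sim] by metis
          show "f \<in> edges G' \<union> edges F \<union> {{u, x}}"
          proof (cases "p \<in> ?X \<or> q \<in> ?X")
            case True
            have edge_X: "{y, z} \<in> {{x, a}, {x, b}, {x, u}}" if "adj G y z" "y \<in> ?X" for y z
            proof -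
              have "y = x \<or> y = a \<or> y = b" using that(2) by simp
              then show ?thesis
                using that(1) by (elim disjE) (simp_all add: adj_x adj_a adj_b insert_commute, auto)
            qed
            have "adj G q p" using pq(2) by (simp add: adj_commute)
            then have "f \<in> {{x, a}, {x, b}, {x, u}}"
              using True pq edge_X[of p q] edge_X[of q p] by (metis insert_commute)
            then show ?thesis by (auto simp: F_def insert_commute)
          next
            case False
            with pq simple_graph_adjD[OF sim pq(2)] \<open>f \<in> edges G\<close> show ?thesis by (auto simp: G'_def)
          qed
        qed
      qed
      moreover have "verts G' \<inter> verts F = {}" "verts G = verts G' \<union> verts F" "u \<in> verts G'" "S u = StC"
        using VG' abV x(1) u dis SC by (auto simp: F_def)
      ultimately show ?thesis unfolding op5_def statuses_kept_def
        by (intro exI[of _ F] exI[of _ S] exI[of _ u] exI[of _ x]) simp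
    qed
    moreover have "c \<in> verts G' - outer G' S" using c x(2) unfolding inn' by simp
    ultimately show ?thesis by blast
  qed
qed

lemma op5_card:
  assumes "op5 G' S' G S" "finite (verts G)"
  shows "card (verts G') < card (verts G)"
proof (rule psubset_card_mono[OF assms(2)])
  obtain F J x where "is_F1 x F J" "verts G' \<inter> verts F = {}" "verts G = verts G' \<union> verts F"
    using assms(1) unfolding op5_def by blast
  moreover from this have "verts F \<noteq> {}" unfolding is_F1_def by blast
  ultimately show "verts G' \<subset> verts G" by blast
qed

lemma corona_T:
  assumes "labeled_K2bar_corona_tree G S"
  shows "T_01_02 G S"
  using assms
proof (induction "card (verts G)" arbitrary: G rule: less_induct)
  case less
  have "block G S" using less.prems by (simp add: block_def)
  then obtain c where "c \<in> verts G - outer G S" using block_inner by blast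
  with corona_peel[OF less.prems]
  consider "is_H3 G S" | G' where "labeled_K2bar_corona_tree G' S" "op5 G' S G S" by metis
  then show ?case
  proof cases
    case 1
    then show ?thesis by (rule T_01_02.start_H3)
  next
    case 2
    have "finite (verts G)" using block_simple[OF \<open>block G S\<close>] simple_graph_finite by blast
    with 2 less.hyps op5_card show ?thesis by (metis T_01_02.step_op5)
  qed
qed

text \<open>The attachment is simulated by attaching a smaller corona at \<open>w\<close> and then
  restoring the peeled stems by \<open>op5\<close>. Hence \<open>w\<close> must never be peeled off,
  which is achieved by protecting its stem \<open>c\<close>.\<close>

lemma corona_attach_T:
  assumes "labeled_K2bar_corona_tree K I" "T_01_02 G' S'" "identify_at_A G' S' K I G S"
  shows "T_01_02 G S"
  using assms(1,3)
proof (induction "card (verts K)" arbitrary: K G rule: less_induct)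
  case less
  have K: "tree K" "corona_on K (outer K I)" using less.prems(1) by (auto simp: labeled_corona_iff)
  note sK = tree_simple[OF K(1)]
  obtain w where w: "verts G' \<inter> verts K = {w}" "S' w = StA" "I w = StA"
    using less.prems(2) unfolding identify_at_A_def by blast
  have V: "verts G = verts G' \<union> verts K" and E: "edges G = edges G' \<union> edges K"
    and S: "\<And>v. v \<in> verts G' \<Longrightarrow> S v = S' v" "\<And>v. v \<in> verts K \<Longrightarrow> S v = I v"
    using less.prems(2) by (auto simp: identify_at_A_def statuses_kept_def)
  have "w \<in> outer K I" using w by (auto simp: outer_def)
  then obtain c where c: "c \<in> verts K - outer K I" "adj K w c"
    using corona_on_stem[OF K(2)] by (metis DiffI)
  from corona_peel[OF less.prems(1) c(1)] consider "is_H3 K I"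
    | K' where "labeled_K2bar_corona_tree K' I" "op5 K' I K I" "c \<in> verts K' - outer K' I" by metis
  then show ?case
  proof cases
    case 1
    then have "op6 G' S' G S" using less.prems(2) unfolding op6_def by blast
    with assms(2) show ?thesis by (rule T_01_02.step_op6)
  next
    case 2
    from 2(2) obtain F J u x where F: "is_F1 x F J" and dis: "verts K' \<inter> verts F = {}"
      and u: "u \<in> verts K'" "I u = StC"
      and VK: "verts K = verts K' \<union> verts F" and EK: "edges K = edges K' \<union> edges F \<union> {{u, x}}"
      and J: "\<And>v. v \<in> verts F \<Longrightarrow> I v = J v"
      by (auto simp: op5_def statuses_kept_def)
    obtain a b where ab: "distinct [a, x, b]" "verts F = {a, x, b}"
      "edges F = {{a, x}, {x, b}}" "J x = StC" using F by (auto simp: is_F1_def)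
    have sK': "simple_graph K'" using 2(1) tree_simple by (auto simp: labeled_corona_iff)
    \<comment> \<open>If \<open>w\<close> were removed, it would be one of the two removed leaves,
      whose only neighbour is \<open>x\<close>; but its neighbour \<open>c\<close> remains in
      \<open>K'\<close>.\<close>
    have "w \<in> verts K'"
    proof (rule ccontr)
      assume wn: "w \<notin> verts K'"
      have "w \<in> verts F" using w VK wn by blast
      moreover have "w \<noteq> x" using J[of x] ab w by auto
      ultimately have wab: "w = a \<or> w = b" using ab by auto
      have "c \<in> verts K'" using 2(3) by blast
      have "{w, c} \<notin> edges K'" using wn simple_graph_adjD(1)[OF sK'] by (auto simp: adj_def)
      then have "{w, c} \<in> edges F \<union> {{u, x}}" using c(2) EK by (auto simp: adj_def)
      then show False using \<open>c \<in> verts K'\<close> wab wn u dis ab by (auto simp: doubleton_eq_iff)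
    qed
    define M where "M = \<lparr>verts = verts G' \<union> verts K', edges = edges G' \<union> edges K'\<rparr>"
    have i: "verts G' \<inter> verts K' = {w}" using \<open>w \<in> verts K'\<close> w VK by blast
    then have "identify_at_A G' S' K' I M S"
      unfolding identify_at_A_def statuses_kept_def
      using w S VK by (intro conjI exI[of _ w]) (auto simp: M_def)
    moreover have "card (verts K') < card (verts K)"
      using op5_card[OF 2(2)] simple_graph_finite[OF sK] by simp
    ultimately have M: "T_01_02 M S" using less.hyps 2(1) by blast
    have "verts M \<inter> verts F = {}" using dis w VK \<open>w \<in> verts K'\<close> by (auto simp: M_def)
    then have "op5 M S G S"
      unfolding op5_def statuses_kept_def
      by (intro exI[of _ F] exI[of _ J] exI[of _ u] exI[of _ x])
        (use F u VK EK V E S J in \<open>auto simp: M_def\<close>)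
    with M show ?thesis by (rule T_01_02.step_op5)
  qed
qed

lemma T'_imp_T: "T'_01_02 G S \<Longrightarrow> T_01_02 G S"
proof (induction rule: T'_block_induct)
  case (block G S)
  then show ?case using corona_T T_01_02.start_H2 by (auto simp: block_def)
next
  case (step G' S' K I G S)
  show ?case
  proof (cases "is_H2 K I")
    case True
    then have "op6 G' S' G S" using step unfolding op6_def by blast
    with step show ?thesis using T_01_02.step_op6 by blast
  next
    case False
    with step show ?thesis using corona_attach_T unfolding block_def by blast
  qed
qed

lemma H3_corona:
  assumes "is_H3 G S"
  shows "labeled_K2bar_corona_tree G S"
proof -
  obtain x y a a' b b' where H: "distinct [x, y, a, a', b, b']"
     "verts G = {x, y, a, a', b, b'}"
     "edges G = {{x, y}, {x, a}, {x, a'}, {y, b}, {y, b'}}"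
     "S x = StC" "S y = StC" "S a = StA" "S a' = StA" "S b = StA" "S b' = StA"
    using assms unfolding is_H3_def by (elim exE conjE)
  have pair: "\<exists>u v. {p, q} = {u, v} \<and> u \<noteq> v \<and> u \<in> V \<and> v \<in> V"
    if "p \<noteq> q" "p \<in> V" "q \<in> V" for p q :: 'a and V
    using that by blast
  have sim: "simple_graph G"
    unfolding simple_graph_def H(2,3) ball_simps by (intro conjI pair) (use H(1) in auto)
  have adj: "\<And>v. adj G x v \<longleftrightarrow> v = y \<or> v = a \<or> v = a'" "\<And>v. adj G y v \<longleftrightarrow> v = x \<or> v = b \<or> v = b'"
    "\<And>v. adj G a v \<longleftrightarrow> v = x" "\<And>v. adj G a' v \<longleftrightarrow> v = x" "\<And>v. adj G b v \<longleftrightarrow> v = y" "\<And>v. adj G b' v \<longleftrightarrow> v = y"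
    using H(1) by (auto simp: adj_def H(3) doubleton_eq_iff)
  have "connected_graph G"
  proof (rule connected_graphI)
    fix v assume "v \<in> verts G"
    have y: "(adj G)\<^sup>*\<^sup>* y x" using adj(2) by blast
    then have "(adj G)\<^sup>*\<^sup>* b x" "(adj G)\<^sup>*\<^sup>* b' x"
      using adj(5)[of y] adj(6)[of y] by (auto intro: converse_rtranclp_into_rtranclp[of "adj G" _ y x])
    moreover have "(adj G)\<^sup>*\<^sup>* a x" "(adj G)\<^sup>*\<^sup>* a' x" using adj(3,4) by blast+
    ultimately show "(adj G)\<^sup>*\<^sup>* v x" using y \<open>v \<in> verts G\<close> by (auto simp: H(2))
  qed
  moreover have "\<nexists>p. is_cycle G p"
  proof
    assume "\<exists>p. is_cycle G p"
    then obtain p where p: "is_cycle G p" ..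
    have "a \<notin> set p" "a' \<notin> set p" "b \<notin> set p" "b' \<notin> set p"
      using cycle_two_neighbours[OF p] adj by metis+
    moreover from this have "x \<notin> set p" "y \<notin> set p"
      using cycle_two_neighbours[OF p] adj by metis+
    ultimately show False using p by (cases p) (auto simp: is_cycle_def H(2))
  qed
  ultimately have "tree G" using sim by (simp add: tree_def)
  moreover have out: "outer G S = {a, a', b, b'}" using H by (auto simp: outer_def)
  moreover have inn: "verts G - outer G S = {x, y}" unfolding out using H by auto
  moreover have "corona_on G (outer G S)"
  proof -
    have "nbhd G a = {x}" "nbhd G a' = {x}" "nbhd G b = {y}" "nbhd G b' = {y}"
      using adj by (auto simp: nbhd_def)
    moreover have "nbhd G x \<inter> outer G S = {a, a'}" "nbhd G y \<inter> outer G S = {b, b'}"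
      using adj H(1) by (auto simp: out)
    ultimately show ?thesis unfolding corona_on_def inn using H(1,2) by (auto simp: out)
  qed
  ultimately show ?thesis unfolding labeled_corona_iff inn using H by auto
qed

lemma T_imp_T': "T_01_02 G S \<Longrightarrow> T'_01_02 G S"
proof (induction rule: T_01_02.induct)
  case (start_H2 G S)
  then show ?case by (rule T'_01_02.start_H2)
next
  case (start_H3 G S)
  then show ?case by (intro T'_01_02.start_corona H3_corona)
next
  case (step_op5 G' S' G S)
  then show ?case using T'_op5 by blast
next
  case (step_op6 G' S' G S)
  then obtain H I where "block H I" "identify_at_A G' S' H I G S"
    unfolding op6_def block_def using H3_corona by blast
  with step_op6 T'_step show ?case by blast
qed

section \<open>Decomposing a tree\<close>

lemma weight_balance:
  assumes "\<And>v. v \<in> verts G \<Longrightarrow> g v + p v = f v + q v"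
  shows "weight G g + sum p (verts G) = weight G f + sum q (verts G)"
proof -
  have "(\<Sum>v\<in>verts G. g v + p v) = (\<Sum>v\<in>verts G. f v + q v)"
    by (rule sum.cong) (use assms in auto)
  then show ?thesis by (simp add: weight_def sum.distrib)
qed

lemma sum_indicator_card: "finite V \<Longrightarrow> P \<subseteq> V \<Longrightarrow> (\<Sum>v\<in>V. if v \<in> P then 1 else 0 :: nat) = card P"
  by (simp add: sum.If_cases Int_absorb1)

definition mix :: "'a set \<Rightarrow> ('a \<Rightarrow> nat) \<Rightarrow> ('a \<Rightarrow> nat) \<Rightarrow> 'a \<Rightarrow> nat" where
  "mix X f g v = (if v \<in> X then g v else f v)"

lemma weight_mix: "weight G (mix X f g) + weight G (mix X g f) = weight G f + weight G g"
  unfolding weight_def sum.distrib[symmetric] by (rule sum.cong) (auto simp: mix_def)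

text \<open>The last two assumptions say that the only edge leaving \<open>X\<close> carries no domination.\<close>

lemma RDF_mix:
  assumes sim: "simple_graph G" and f: "RDF G f" and g: "RDF G g"
    and cut: "\<And>x y. x \<in> X \<Longrightarrow> y \<notin> X \<Longrightarrow> adj G x y \<Longrightarrow> x = v \<and> y = u"
    and fu: "f u \<noteq> 0 \<or> f v \<noteq> 2" and gv: "g v \<noteq> 0 \<or> g u \<noteq> 2"
  shows "RDF G (mix X f g)"
proof (rule RDF_I[OF sim])
  fix z assume z: "z \<in> verts G"
  then show "mix X f g z = 0 \<or> mix X f g z = 1 \<or> mix X f g z = 2"
    using RDF_range[OF f z] RDF_range[OF g z] by (simp add: mix_def)
  assume 0: "mix X f g z = 0"
  show "\<exists>y. adj G z y \<and> mix X f g y = 2"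
  proof (cases "z \<in> X")
    case True
    with 0 RDF_dominated[OF g z] obtain y where y: "adj G z y" "g y = 2" by (auto simp: mix_def)
    have "y \<in> X"
    proof (rule ccontr)
      assume "y \<notin> X"
      with cut[OF True this y(1)] gv 0 y True show False by (auto simp: mix_def)
    qed
    with y show ?thesis by (auto simp: mix_def)
  next
    case False
    with 0 RDF_dominated[OF f z] obtain y where y: "adj G z y" "f y = 2" by (auto simp: mix_def)
    have "y \<notin> X"
    proof
      assume "y \<in> X"
      moreover have "adj G y z" using y(1) by (simp add: adj_commute)
      ultimately show False using cut[OF _ False] fu 0 y False by (auto simp: mix_def)
    qed
    with y show ?thesis by (auto simp: mix_def)
  qed
qed

text \<open>The two complementary mixes have the same total weight as \<open>f\<close> and
  \<open>g\<close>. Both are legal because the edge carries no domination in either function, so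
  both are minimum.\<close>

lemma gamma_mix:
  assumes t: "tree G" and uv: "adj G u v" and f: "gamma_R_function G f" and g: "gamma_R_function G g"
    and "f u \<noteq> 0 \<or> f v \<noteq> 2" "g v \<noteq> 0 \<or> g u \<noteq> 2" "g u \<noteq> 0 \<or> g v \<noteq> 2" "f v \<noteq> 0 \<or> f u \<noteq> 2"
  shows "\<exists>h. gamma_R_function G h \<and> h u = f u \<and> h v = g v"
proof -
  note sim = tree_simple[OF t]
  let ?X = "beyond G u v"
  have cut: "x = v \<and> y = u" if "x \<in> ?X" "y \<notin> ?X" "adj G x y" for x y
    using beyond_cut[OF t uv that] by blast
  note R = gamma_R_function_RDF[OF f] gamma_R_function_RDF[OF g]
  have 1: "RDF G (mix ?X f g)" by (rule RDF_mix[OF sim R cut assms(5,6)])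
  have 2: "RDF G (mix ?X g f)" by (rule RDF_mix[OF sim R(2,1) cut assms(7,8)])
  have "weight G (mix ?X f g) \<le> weight G f"
    using weight_mix[of G ?X f g] gamma_R_function_le[OF g 2] by simp
  with gamma_R_function_eqI[OF f 1] have "gamma_R_function G (mix ?X f g)" by blast
  moreover have "mix ?X f g u = f u" "mix ?X f g v = g v"
    using beyond_props[OF sim uv] beyond_refl[of v G u] by (auto simp: mix_def)
  ultimately show ?thesis by blast
qed

text \<open>Minimum functions with 1 at \<open>a\<close> and with 1 at \<open>b\<close> have no 2 on
  the edge, so mixing gives one with 1 at both ends. Shifting these values to 2 and 0 keeps it
  minimum, although an outer vertex never has value 2.\<close>

lemma outer_independent:
  assumes t: "tree G" and s: "splits G A" and a: "a \<in> A" "b \<in> A"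
  shows "\<not> adj G a b"
proof
  assume ab: "adj G a b"
  note sim = tree_simple[OF t]
  obtain f where f: "gamma_R_function G f" "f a = 1" using splits_outer_ex[OF s a(1)] by blast
  obtain g where g: "gamma_R_function G g" "g b = 1" using splits_outer_ex[OF s a(2)] by blast
  have "f a \<noteq> 2" "f b \<noteq> 2" "g a \<noteq> 2" "g b \<noteq> 2"
    using splits_outer[OF s f(1) a(1)] splits_outer[OF s f(1) a(2)] splits_outer[OF s g(1) a(1)]
      splits_outer[OF s g(1) a(2)] by auto
  then obtain h where h: "gamma_R_function G h" "h a = 1" "h b = 1"
    using gamma_mix[OF t ab f(1) g(1)] f(2) g(2) by auto
  define k where "k = h(b := 0, a := 2)"
  note R = gamma_R_function_RDF[OF h(1)]
  note abD = simple_graph_adjD[OF sim ab]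
  have "RDF G k"
  proof (rule RDF_I[OF sim])
    fix v assume v: "v \<in> verts G"
    then show "k v = 0 \<or> k v = 1 \<or> k v = 2" using RDF_range[OF R v] by (simp add: k_def)
    assume 0: "k v = 0"
    show "\<exists>u. adj G v u \<and> k u = 2"
    proof (cases "v = b")
      case True
      with ab show ?thesis by (intro exI[of _ a]) (simp add: k_def adj_commute)
    next
      case False
      with 0 have "h v = 0" by (auto simp: k_def split: if_splits)
      with RDF_dominated[OF R v] obtain u where "adj G v u" "h u = 2" by blast
      with h show ?thesis by (intro exI[of _ u]) (auto simp: k_def)
    qed
  qed
  moreover have "weight G k = weight G h"
    using weight_upd[OF simple_graph_finite[OF sim] abD(2), of h 0]
      weight_upd[OF simple_graph_finite[OF sim] abD(1), of "h(b := 0)" 2] h abD(3)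
    by (simp add: k_def)
  ultimately have "gamma_R_function G k" using gamma_R_function_eqI[OF h(1)] by simp
  from splits_outer[OF s this a(1)] show False by (simp add: k_def)
qed

section \<open>Trees in which every outer vertex is a leaf\<close>

locale pendant_split =
  fixes G :: "'a graph" and A :: "'a set"
  assumes tree: "tree G" and split: "splits G A"
    and stem: "\<And>a. a \<in> A \<Longrightarrow> \<exists>d\<in>verts G - A. nbhd G a = {d}"
begin

abbreviation leaves :: "'a \<Rightarrow> 'a set" where
  "leaves d \<equiv> nbhd G d \<inter> A"

lemma sim: "simple_graph G"
  using tree by (rule tree_simple)

lemma fin: "finite (verts G)"
  using sim by (rule simple_graph_finite)

lemma adjD: "adj G u v \<Longrightarrow> u \<in> verts G \<and> v \<in> verts G \<and> u \<noteq> v"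
  using simple_graph_adjD[OF sim] by blast

lemma A_sub: "A \<subseteq> verts G"
  using split by (simp add: splits_def)

lemma leaves_sub: "leaves d \<subseteq> verts G"
  using A_sub by blast

lemma leaf_only:
  assumes "adj G d a" "a \<in> A"
  shows "d \<in> verts G" "d \<notin> A" "\<And>u. adj G a u \<longleftrightarrow> u = d"
proof -
  obtain c where c: "c \<in> verts G - A" "nbhd G a = {c}" using stem[OF assms(2)] by blast
  moreover have "d \<in> nbhd G a" using assms(1) by (simp add: adj_commute)
  ultimately have "c = d" by simp
  with c show "d \<in> verts G" "d \<notin> A" "\<And>u. adj G a u \<longleftrightarrow> u = d" by (auto simp: nbhd_def)
qed

text \<open>A leaf of value 0 can be dominated by \<open>d\<close> alone; a leaf of value 1 excludes
  2 at \<open>d\<close>, and an inner vertex has no other nonzero value.\<close>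

lemma leaf_value:
  assumes f: "gamma_R_function G f" and "adj G d a" "a \<in> A"
  shows "f d = 2 \<and> f a = 0 \<or> f d = 0 \<and> f a = 1"
proof -
  note d = leaf_only[OF assms(2,3)]
  have a: "a \<in> verts G" "adj G a d" using assms(2) adjD by (auto simp: adj_commute)
  consider "f a = 0" | "f a = 1" using splits_outer[OF split f assms(3)] by metis
  then show ?thesis
  proof cases
    case 1
    with RDF_dominated[OF gamma_R_function_RDF[OF f] a(1)] d show ?thesis by auto
  next
    case 2
    with outer_one_not_adj_two[OF sim f a(2)] splits_inner[OF split f d(1,2)] show ?thesis by auto
  qed
qed

definition raise :: "('a \<Rightarrow> nat) \<Rightarrow> 'a \<Rightarrow> 'a \<Rightarrow> nat" where
  "raise f d v = (if v = d then 2 else if v \<in> leaves d then 0 else f v)"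

text \<open>A 0 at \<open>d\<close> forces 1 on each of its leaves, so 2 is spent and one is saved
  per leaf; no 2 is lowered.\<close>

lemma raise:
  assumes f: "gamma_R_function G f" and d: "d \<in> verts G" "d \<notin> A" "f d = 0"
  shows "RDF G (raise f d)" "weight G (raise f d) + card (leaves d) = weight G f + 2"
proof -
  note R = gamma_R_function_RDF[OF f]
  have one: "f a = 1" if "a \<in> leaves d" for a using leaf_value[OF f, of d a] that d by auto
  show "RDF G (raise f d)"
  proof (rule RDF_I[OF sim])
    fix v assume v: "v \<in> verts G"
    then show "raise f d v = 0 \<or> raise f d v = 1 \<or> raise f d v = 2"
      using RDF_range[OF R v] by (simp add: raise_def)
    assume 0: "raise f d v = 0"
    show "\<exists>u. adj G v u \<and> raise f d u = 2"
    proof (cases "v \<in> leaves d")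
      case True
      then show ?thesis by (intro exI[of _ d]) (simp add: raise_def adj_commute)
    next
      case False
      with 0 have "f v = 0" by (auto simp: raise_def split: if_splits)
      with RDF_dominated[OF R v] obtain u where "adj G v u" "f u = 2" by blast
      with one show ?thesis by (intro exI[of _ u]) (auto simp: raise_def)
    qed
  qed
  have "weight G (raise f d) + (\<Sum>v\<in>verts G. if v \<in> leaves d then 1 else 0)
      = weight G f + (\<Sum>v\<in>verts G. if v = d then 2 else 0)"
    by (rule weight_balance) (use one d in \<open>auto simp: raise_def\<close>)
  then show "weight G (raise f d) + card (leaves d) = weight G f + 2"
    unfolding sum_indicator_card[OF fin leaves_sub] using d fin by simp
qed

text \<open>With three leaves, raising a 0 at \<open>d\<close> would reduce the weight of a minimum
  function.\<close>

lemma card_leaves_le: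
  assumes "d \<in> verts G" "d \<notin> A"
  shows "card (leaves d) \<le> 2"
proof -
  obtain f where f: "gamma_R_function G f" "f d = 0" using splits_inner_ex[OF split assms] by blast
  show ?thesis
    using raise[OF f(1) assms f(2)] gamma_R_function_le[OF f(1)] by fastforce
qed

lemma inner_neighbour:
  assumes "d \<in> verts G" "d \<notin> A"
  obtains e where "adj G d e" "e \<notin> A"
proof -
  obtain f where f: "gamma_R_function G f" "f d = 0" using splits_inner_ex[OF split assms] by blast
  from RDF_dominated[OF gamma_R_function_RDF[OF f(1)] assms(1) f(2)]
  obtain e where "adj G d e" "f e = 2" by blast
  with splits_two_notin[OF split f(1)] adjD that show thesis by blast
qed

text \<open>Take a minimum function with 2 at \<open>d\<close>. If \<open>p\<close> has 2 as well,
  \<open>d\<close> can drop to 0; if \<open>p\<close> has 0, the values 2, 0 can become 1, 1, giving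
  an inner vertex the value 1.\<close>

lemma not_end_vertex:
  assumes "d \<in> verts G" "d \<notin> A"
  shows "nbhd G d \<noteq> {p}"
proof
  assume n: "nbhd G d = {p}"
  then have dp: "\<And>u. adj G d u \<longleftrightarrow> u = p" by (auto simp: nbhd_def)
  have p: "p \<in> verts G" "p \<noteq> d" "p \<notin> A" using inner_neighbour[OF assms] dp adjD by metis+
  have pd: "\<And>u. adj G u d \<longleftrightarrow> u = p" using dp by (simp add: adj_commute)
  obtain f where f: "gamma_R_function G f" "f d = 2" using splits_inner_ex[OF split assms] by blast
  note R = gamma_R_function_RDF[OF f(1)]
  consider "f p = 2" | "f p = 0" using splits_inner[OF split f(1) p(1,3)] by metis
  then show False
  proof cases
    case 1
    have "RDF G (f(d := 0))"
    proof (rule RDF_I[OF sim])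
      fix v assume v: "v \<in> verts G"
      then show "(f(d := 0)) v = 0 \<or> (f(d := 0)) v = 1 \<or> (f(d := 0)) v = 2"
        using RDF_range[OF R v] by simp
      assume 0: "(f(d := 0)) v = 0"
      show "\<exists>u. adj G v u \<and> (f(d := 0)) u = 2"
      proof (cases "v = d")
        case True
        with dp p 1 show ?thesis by auto
      next
        case False
        with 0 RDF_dominated[OF R v] obtain u where u: "adj G v u" "f u = 2" by auto
        have "u \<noteq> d" using u pd[of v] 0 1 p by auto
        with u show ?thesis by auto
      qed
    qed
    from gamma_R_function_le[OF f(1) this] weight_upd[OF fin assms(1), of f 0] f(2)
    show False by simp
  next
    case 2
    define k where "k = f(d := 1, p := 1)"
    have "RDF G k"
    proof (rule RDF_I[OF sim])
      fix v assume v: "v \<in> verts G"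
      then show "k v = 0 \<or> k v = 1 \<or> k v = 2"
        using RDF_range[OF R v] by (simp add: k_def)
      assume 0: "k v = 0"
      then have vv: "v \<noteq> d" "v \<noteq> p" "f v = 0" by (auto simp: k_def split: if_splits)
      with RDF_dominated[OF R v] obtain u where u: "adj G v u" "f u = 2" by auto
      have "u \<noteq> d" using u pd[of v] vv by auto
      moreover have "u \<noteq> p" using u 2 by auto
      ultimately show "\<exists>u. adj G v u \<and> k u = 2" using u by (auto simp: k_def)
    qed
    moreover have "weight G k = weight G f"
      using weight_upd[OF fin assms(1), of f 1] weight_upd[OF fin p(1), of "f(d := 1)" 1] f(2) 2 p
      by (simp add: k_def)
    ultimately have "gamma_R_function G k" using gamma_R_function_eqI[OF f(1)] by simp
    from splits_inner[OF split this assms] p show False by (simp add: k_def)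
  qed
qed

text \<open>Suppose a minimum function had 0 at \<open>p\<close> and 2 at another inner neighbour
  \<open>q\<close>. Then \<open>l\<close> has no dominator and must have 2; since \<open>q\<close>
  takes care of \<open>p\<close>, the values 2, 0 on \<open>l\<close>, \<open>a\<close> can become
  1, 1, which is impossible at the inner vertex \<open>l\<close>. Yet 0 at \<open>p\<close> and 2 at
  \<open>q\<close> are attained separately and can be mixed.\<close>

lemma path_end:
  assumes l: "nbhd G l = {a, p}" and a: "a \<in> A" and p: "p \<notin> A"
    and q: "adj G p q" "q \<notin> A"
  shows "q = l"
proof (rule ccontr)
  assume ql: "q \<noteq> l"
  have la: "adj G l a" and lp: "adj G l p" and l_adj: "\<And>u. adj G l u \<longleftrightarrow> u = a \<or> u = p"
    using l by (auto simp: nbhd_def)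
  note lD = leaf_only[OF la a]
  have V: "l \<in> verts G" "a \<in> verts G" "p \<in> verts G" "q \<in> verts G" "p \<noteq> l" "q \<noteq> p"
    using adjD[OF la] adjD[OF lp] adjD[OF q(1)] by auto
  have claim: "f q = 0" if f: "gamma_R_function G f" and fp: "f p = 0" for f
  proof (rule ccontr)
    assume "f q \<noteq> 0"
    then have fq: "f q = 2" using splits_inner[OF split f V(4) q(2)] by metis
    note R = gamma_R_function_RDF[OF f]
    have "f a \<noteq> 2" "f p \<noteq> 2" using fp splits_outer[OF split f a] by auto
    then have "f l \<noteq> 0" using RDF_dominated[OF R V(1)] l_adj by metis
    with leaf_value[OF f la a] have fl: "f l = 2" "f a = 0" by auto
    define k where "k = f(l := 1, a := 1)"
    have "RDF G k"
    proof (rule RDF_I[OF sim])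
      fix v assume v: "v \<in> verts G"
      then show "k v = 0 \<or> k v = 1 \<or> k v = 2"
        using RDF_range[OF R v] by (simp add: k_def)
      assume 0: "k v = 0"
      then have vv: "v \<noteq> l" "v \<noteq> a" "f v = 0" by (auto simp: k_def split: if_splits)
      show "\<exists>u. adj G v u \<and> k u = 2"
      proof (cases "v = p")
        case True
        with q ql fq a show ?thesis by (intro exI[of _ q]) (auto simp: k_def)
      next
        case False
        with RDF_dominated[OF R v] vv obtain u where u: "adj G v u" "f u = 2" by auto
        have "u \<noteq> l" using u l_adj[of v] vv False by (auto simp: adj_commute)
        moreover have "u \<noteq> a" using u fl by auto
        ultimately show ?thesis using u by (auto simp: k_def)
      qed
    qed
    moreover have "weight G k = weight G f"
      using weight_upd[OF fin V(1), of f 1] weight_upd[OF fin V(2), of "f(l := 1)" 1] fl adjD[OF la]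
      by (auto simp: k_def)
    ultimately have "gamma_R_function G k" using gamma_R_function_eqI[OF f] by simp
    from splits_inner[OF split this lD(1,2)] a lD(2) show False by (auto simp: k_def split: if_splits)
  qed
  obtain f where f: "gamma_R_function G f" "f p = 0" using splits_inner_ex[OF split V(3) p] by blast
  obtain g where g: "gamma_R_function G g" "g q = 2" using splits_inner_ex[OF split V(4) q(2)] by blast
  \<comment> \<open>By the claim neither function has a 0 facing a 2 on the edge from
    \<open>p\<close> to \<open>q\<close>, as mixing requires.\<close>
  have "f q = 0" "g p \<noteq> 0" using claim f g by (blast, metis zero_neq_numeral)
  then obtain h where "gamma_R_function G h" "h p = f p" "h q = g q"
    using gamma_mix[OF tree q(1) f(1) g(1)] f(2) g(2) by auto
  with claim f g show False by (metis zero_neq_numeral)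
qed

text \<open>A neighbour \<open>e\<close> with two leaves can be given the value 2 for free; then the value 2 at \<open>d\<close> is
  wasteful.\<close>

lemma no_full_neighbour:
  assumes d: "d \<in> verts G" "d \<notin> A" and few: "card (leaves d) \<le> 1"
    and e: "adj G d e" "e \<notin> A" "card (leaves e) = 2"
    and defective: "\<And>q. adj G d q \<Longrightarrow> q \<notin> A \<Longrightarrow> card (leaves q) \<noteq> 2 \<Longrightarrow> q = y"
  shows False
proof -
  \<comment> \<open>The least sum over \<open>A\<close> is a tie-break: raising a neighbour with two
    leaves from 0 to 2 keeps the weight but lowers this sum, so in the chosen function all such
    neighbours have 2.\<close>
  define P where "P f \<longleftrightarrow> gamma_R_function G f \<and> f d = 2" for f
  obtain f0 where "P f0" using splits_inner_ex[OF split d] by (metis P_def)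
  then obtain f where f: "P f" and mn: "\<And>g. P g \<Longrightarrow> sum f A \<le> sum g A"
    using ex_has_least_nat[of P f0 "\<lambda>f. sum f A"] by blast
  have gf: "gamma_R_function G f" and fd: "f d = 2" using f by (auto simp: P_def)
  note R = gamma_R_function_RDF[OF gf]
  have full: "f q = 2" if q: "adj G d q" "q \<notin> A" "card (leaves q) = 2" for q
  proof (rule ccontr)
    assume "f q \<noteq> 2"
    have qV: "q \<in> verts G" "q \<noteq> d" using adjD[OF q(1)] by auto
    with \<open>f q \<noteq> 2\<close> have f0: "f q = 0" using splits_inner[OF split gf qV(1) q(2)] by metis
    note r = raise[OF gf qV(1) q(2) f0]
    have "gamma_R_function G (raise f q)"
      using gamma_R_function_eqI[OF gf r(1)] r(2) q(3) by simp
    moreover have "raise f q d = 2" using qV d fd by (auto simp: raise_def)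
    ultimately have "sum f A \<le> sum (raise f q) A" using mn by (simp add: P_def)
    moreover have "sum (raise f q) A < sum f A"
    proof (rule sum_strict_mono_ex1)
      show "finite A" using A_sub fin finite_subset by blast
      show "\<forall>x\<in>A. raise f q x \<le> f x" using q by (auto simp: raise_def)
      have "leaves q \<noteq> {}" using q(3) by (metis card.empty zero_neq_numeral)
      then obtain a where a: "a \<in> leaves q" by blast
      then have "f a = 1" using leaf_value[OF gf, of q a] f0 by auto
      with a q show "\<exists>x\<in>A. raise f q x < f x" by (intro bexI[of _ a]) (auto simp: raise_def)
    qed
    ultimately show False by simp
  qed
  \<comment> \<open>The inner neighbours that may depend on the 2 at \<open>d\<close>; only
    \<open>y\<close> can be among them.\<close>
  define Z where "Z = {v \<in> nbhd G d. v \<notin> A \<and> f v = 0}"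
  have "Z \<subseteq> {y}" using full defective by (force simp: Z_def)
  then have Z1: "card Z \<le> 1" using card_mono[of "{y}" Z] by simp
  \<comment> \<open>Removing the 2 at \<open>d\<close> saves 2 and costs at most 1 for a leaf and 1
    for \<open>Z\<close>, while \<open>e\<close> dominates \<open>d\<close>.\<close>
  define k where "k v = (if v = d then 0 else if v \<in> leaves d \<union> Z then 1 else f v)" for v
  have zero: "f v = 0" if "v \<in> leaves d \<union> Z" for v
    using that leaf_value[OF gf] fd by (fastforce simp: Z_def)
  have dn: "d \<notin> leaves d \<union> Z" using d fd zero by auto
  have Rk: "RDF G k"
  proof (rule RDF_I[OF sim])
    fix v assume v: "v \<in> verts G"
    then show "k v = 0 \<or> k v = 1 \<or> k v = 2" using RDF_range[OF R v] by (simp add: k_def)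
    assume 0: "k v = 0"
    show "\<exists>u. adj G v u \<and> k u = 2"
    proof (cases "v = d")
      case True
      have "f e = 2" by (rule full[OF e])
      with True e(1) zero[of e] adjD[OF e(1)] show ?thesis by (intro exI[of _ e]) (auto simp: k_def)
    next
      case False
      with 0 have v0: "f v = 0" "v \<notin> leaves d \<union> Z" by (auto simp: k_def split: if_splits)
      with RDF_dominated[OF R v] obtain u where u: "adj G v u" "f u = 2" by blast
      have "u \<noteq> d" using u v0 by (auto simp: Z_def adj_commute)
      moreover have "u \<notin> leaves d \<union> Z" using u zero by force
      ultimately show ?thesis using u by (auto simp: k_def)
    qed
  qed
  have LZ: "leaves d \<union> Z \<subseteq> verts G" using leaves_sub adjD by (auto simp: Z_def)
  have "weight G k + (\<Sum>v\<in>verts G. if v = d then 2 else 0)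
      = weight G f + (\<Sum>v\<in>verts G. if v \<in> leaves d \<union> Z then 1 else 0)"
    by (rule weight_balance) (use zero dn fd in \<open>auto simp: k_def\<close>)
  then have wt: "weight G k + 2 = weight G f + card (leaves d \<union> Z)"
    unfolding sum_indicator_card[OF fin LZ] using d fin by simp
  have card: "card (leaves d \<union> Z) \<le> card (leaves d) + card Z" by (rule card_Un_le)
  have gk: "gamma_R_function G k"
    using gamma_R_function_eqI[OF gf Rk] wt card few Z1 by simp
  \<comment> \<open>Since \<open>k\<close> is minimum too, a member of \<open>Z\<close> would be an
    inner vertex of value 1. Without such a member the exchange strictly saves weight.\<close>
  have "Z = {}"
  proof (rule ccontr)
    assume "Z \<noteq> {}"
    then obtain z where z: "z \<in> Z" by blast
    then have "k z = 1" "z \<in> verts G" "z \<notin> A" using dn LZ by (auto simp: k_def Z_def)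
    with splits_inner[OF split gk] show False by fastforce
  qed
  then show False using wt few gamma_R_function_le[OF gf Rk] by simp
qed

lemma classification:
  obtains "corona_on G A"
    | a b c d where "distinct [a, b, c, d]" "verts G = {a, b, c, d}" "A = {a, d}"
      "nbhd G a = {b}" "nbhd G b = {a, c}" "nbhd G c = {b, d}" "nbhd G d = {c}"
proof (cases "\<forall>d\<in>verts G - A. card (leaves d) = 2")
  case True
  then have "corona_on G A" using A_sub stem by (simp add: corona_on_def)
  then show thesis by (rule that(1))
next
  case False
  define B where "B = {d \<in> verts G - A. card (leaves d) \<noteq> 2}"
  from False obtain c where c: "c \<in> B" by (auto simp: B_def)
  have Bsub: "B \<subseteq> verts G" by (auto simp: B_def)
  obtain x y where x: "x \<in> B" "nbhd G x \<inter> B \<subseteq> {y}"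
  proof (cases "\<exists>c'\<in>B. adj G c c'")
    case True
    then show thesis using tree_end_vertex[OF tree Bsub c] that by (metis order_refl)
  next
    \<comment> \<open>Here \<open>x = y = c\<close> is only a placeholder: no vertex is its own
      neighbour, so the inclusion holds. The fact \<open>xy\<close> later shows that
      \<open>y\<close> is a genuine neighbour of \<open>x\<close>.\<close>
    case False
    then have "nbhd G c \<inter> B \<subseteq> {c}" by auto
    with c that show thesis by blast
  qed
  have xV: "x \<in> verts G" "x \<notin> A" "card (leaves x) \<noteq> 2" using x by (auto simp: B_def)
  have few: "card (leaves v) \<le> 1" if "v \<in> B" for v
    using that card_leaves_le[of v] by (auto simp: B_def)
  have defective: "q = y" if "adj G x q" "q \<notin> A" "card (leaves q) \<noteq> 2" for q
    using x(2) that adjD[OF that(1)] by (auto simp: B_def)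
  \<comment> \<open>Neighbours with two leaves are excluded by \<open>no_full_neighbour\<close>, so
    every inner neighbour of \<open>x\<close> lies in \<open>B\<close>.\<close>
  have inner: "q = y \<and> q \<in> B" if "adj G x q" "q \<notin> A" for q
    using that no_full_neighbour[OF xV(1,2) few[OF x(1)] that _ defective] defective[OF that]
      adjD[OF that(1)] by (auto simp: B_def)
  have xy: "adj G x y" "y \<in> B" "y \<notin> A" using inner_neighbour[OF xV(1,2)] inner by metis+
  \<comment> \<open>With no leaf and a single inner neighbour, \<open>v\<close> would be an end
    vertex; more than one leaf is excluded by \<open>v \<in> B\<close>.\<close>
  have one: "\<exists>a. leaves v = {a}" if v: "v \<in> B" "\<And>q. adj G v q \<Longrightarrow> q \<notin> A \<Longrightarrow> q = w" for v w
  proof -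
    have vV: "v \<in> verts G" "v \<notin> A" using v by (auto simp: B_def)
    have "leaves v \<noteq> {}"
    proof
      assume 0: "leaves v = {}"
      obtain q where q: "adj G v q" "q \<notin> A" using inner_neighbour[OF vV] by blast
      then have "adj G v w" using v(2)[OF q] by simp
      moreover have "z = w" if "adj G v z" for z using 0 v(2)[OF that] that by (metis IntI empty_iff nbhd_iff)
      ultimately have "nbhd G v = {w}" unfolding nbhd_def by blast
      with not_end_vertex[OF vV] show False by blast
    qed
    moreover have "finite (leaves v)" using leaves_sub fin finite_subset by blast
    ultimately have "card (leaves v) = 1" using few[OF v(1)] by (simp add: le_Suc_eq)
    then show ?thesis by (auto simp: card_1_singleton_iff)
  qed
  obtain a where a: "leaves x = {a}" using one[OF x(1)] inner by blast
  have aA: "a \<in> A" "adj G x a" using a by auto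
  have nx: "nbhd G x = {a, y}"
  proof -
    have "nbhd G x = leaves x \<union> {q \<in> nbhd G x. q \<notin> A}" by blast
    also have "{q \<in> nbhd G x. q \<notin> A} = {y}" unfolding nbhd_def using inner xy by blast
    finally show ?thesis unfolding a by (simp add: insert_commute)
  qed
  \<comment> \<open>Now \<open>x\<close> has one leaf and one inner neighbour, so
    \<open>path_end\<close> makes the situation symmetric in \<open>x\<close> and
    \<open>y\<close>.\<close>
  have y_inner: "q = x" if "adj G y q" "q \<notin> A" for q
    by (rule path_end[OF nx aA(1) xy(3) that])
  obtain b where b: "leaves y = {b}" using one[OF xy(2)] y_inner by blast
  have bA: "b \<in> A" "adj G y b" using b by auto
  have yx: "adj G y x" using xy(1) by (simp add: adj_commute)
  have ny: "nbhd G y = {x, b}"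
  proof -
    have "nbhd G y = {q \<in> nbhd G y. q \<notin> A} \<union> leaves y" by blast
    also have "{q \<in> nbhd G y. q \<notin> A} = {x}" unfolding nbhd_def using y_inner yx xV by blast
    finally show ?thesis unfolding b by (simp add: insert_commute)
  qed
  have na: "nbhd G a = {x}" and nb: "nbhd G b = {y}"
    using leaf_only(3)[OF aA(2,1)] leaf_only(3)[OF bA(2,1)] by auto
  have xy': "x \<noteq> y" using adjD[OF xy(1)] by simp
  then have "a \<noteq> b" using na nb by auto
  then have dis: "distinct [a, x, y, b]" using aA bA xV xy xy' by auto
  have "verts G \<subseteq> {a, x, y, b}"
  proof (rule connected_graph_closed[of G x])
    fix v u assume "v \<in> {a, x, y, b}" "adj G v u"
    then have "u \<in> nbhd G a \<union> nbhd G x \<union> nbhd G y \<union> nbhd G b" by auto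
    then show "u \<in> {a, x, y, b}" unfolding na nx ny nb by blast
  qed (use tree xV in \<open>auto simp: tree_def\<close>)
  then have V: "verts G = {a, x, y, b}" using xV adjD[OF aA(2)] adjD[OF bA(2)] by auto
  then have "A = {a, b}" using A_sub aA bA xV xy by auto
  with that(2) dis V na nx ny nb show thesis by blast
qed

lemma labeling:
  assumes "verts G - A \<noteq> {}"
  shows "\<exists>L. T'_01_02 G L \<and> outer G L = A"
proof (rule classification)
  assume cor: "corona_on G A"
  define L where "L v = (if v \<in> A then StA else StC)" for v
  have out: "outer G L = A" using A_sub by (auto simp: outer_def L_def)
  obtain c where c: "c \<in> verts G" "c \<notin> A" using assms by blast
  \<comment> \<open>A corona block must have two stems; \<open>e\<close> is the second.\<close>
  obtain e where e: "adj G c e" "e \<notin> A" using inner_neighbour[OF c] by blast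
  have "card {c, e} \<le> card (verts G - A)"
    using c e adjD[OF e(1)] fin by (intro card_mono) auto
  then have "2 \<le> card (verts G - A)" using adjD[OF e(1)] by simp
  then have "labeled_K2bar_corona_tree G L"
    unfolding labeled_corona_iff out using tree cor by (simp add: L_def)
  then show ?thesis using out T'_01_02.start_corona by blast
next
  fix a b c d assume H: "distinct [a, b, c, d]" "verts G = {a, b, c, d}" "A = {a, d}"
      "nbhd G a = {b}" "nbhd G b = {a, c}" "nbhd G c = {b, d}" "nbhd G d = {c}"
  define L where "L v = (if v \<in> A then StA else StB)" for v
  have out: "outer G L = A" using A_sub by (auto simp: outer_def L_def)
  have "edges G = {{a, b}, {b, c}, {c, d}}"
  proof
    have "adj G a b" "adj G b c" "adj G c d" using H by (auto simp: nbhd_def)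
    then show "{{a, b}, {b, c}, {c, d}} \<subseteq> edges G" by (auto simp: adj_def)
    show "edges G \<subseteq> {{a, b}, {b, c}, {c, d}}"
    proof
      fix f assume "f \<in> edges G"
      then obtain p q where pq: "f = {p, q}" "adj G p q" using simple_graph_edge[OF sim] by metis
      have "p = a \<or> p = b \<or> p = c \<or> p = d" using adjD[OF pq(2)] unfolding H(2) by simp
      moreover have "q \<in> nbhd G p" using pq(2) by simp
      ultimately show "f \<in> {{a, b}, {b, c}, {c, d}}"
        unfolding pq(1) by (elim disjE) (simp_all only: H(4-7), auto)
    qed
  qed
  moreover have "L a = StA" "L b = StB" "L c = StB" "L d = StA" using H(1,3) by (auto simp: L_def)
  ultimately have "is_H2 G L" unfolding is_H2_def using H(1,2)
    by (intro exI[of _ a] exI[of _ b] exI[of _ c] exI[of _ d]) (simp only: simp_thms)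
  then show ?thesis using out T'_01_02.start_H2 by blast
qed

end

text \<open>Carrying \<open>outer G L = A\<close> through the induction ensures that the labelings
  of both parts give the cut vertex status A, so that they agree where the parts meet.\<close>

lemma splits_imp_T':
  assumes "tree G" "splits G A" "A \<noteq> {}" "verts G - A \<noteq> {}"
  shows "\<exists>L. T'_01_02 G L \<and> outer G L = A"
  using assms
proof (induction "card (verts G)" arbitrary: G A rule: less_induct)
  case less
  note t = less.prems(1) and s = less.prems(2)
  note sim = tree_simple[OF t]
  note fin = simple_graph_finite[OF sim]
  have A: "A \<subseteq> verts G" using s by (simp add: splits_def)
  have indep: "\<not> adj G a b" if "a \<in> A" "b \<in> A" for a b using outer_independent[OF t s that] .
  show ?case
  proof (cases "\<exists>w\<in>A. \<exists>d e. adj G w d \<and> adj G w e \<and> d \<noteq> e")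
    case True
    then obtain w d e where w: "w \<in> A" and d: "adj G w d" and e: "adj G w e" and de: "d \<noteq> e"
      by blast
    define X where "X = beyond G w d"
    have X: "d \<in> X" "w \<notin> X" "X \<subseteq> verts G"
      using beyond_refl[of d G w] beyond_props[OF sim d] by (auto simp: X_def)
    have cut: "x = d \<and> y = w" if "x \<in> X" "y \<notin> X" "adj G x y" for x y
      using beyond_cut[OF t d] that by (simp add: X_def)
    have eX: "e \<notin> X" using cut[of e w] X e de by (auto simp: adj_commute)
    define G1 where "G1 = induced G (verts G - X)"
    define G2 where "G2 = induced G (insert w X)"
    have wV: "w \<in> verts G" "d \<in> verts G" "e \<in> verts G" "w \<noteq> d" "w \<noteq> e"
      using simple_graph_adjD[OF sim d] simple_graph_adjD[OF sim e] by auto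
    have t1: "tree G1" unfolding G1_def by (rule tree_delete[OF t wV(1) X(2)]) (use cut in blast)
    have t2: "tree G2" unfolding G2_def X_def by (rule tree_induced_beyond[OF t d])
    have V12: "verts G1 = verts G - X" "verts G2 = insert w X" by (simp_all add: G1_def G2_def)
    interpret gluing G1 G2 G w
    proof
      show "simple_graph G1" "simple_graph G2" using t1 t2 tree_simple by auto
      show "verts G1 \<inter> verts G2 = {w}" "verts G = verts G1 \<union> verts G2"
        using X wV by (auto simp: V12)
      show "edges G = edges G1 \<union> edges G2"
      proof
        show "edges G \<subseteq> edges G1 \<union> edges G2"
        proof
          fix f assume f: "f \<in> edges G"
          then obtain p q where pq: "f = {p, q}" "adj G p q" using simple_graph_edge[OF sim] by metis
          then have qp: "adj G q p" by (simp add: adj_commute)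
          have "p \<in> verts G" "q \<in> verts G" using simple_graph_adjD[OF sim pq(2)] by auto
          then have "f \<subseteq> verts G - X \<or> f \<subseteq> insert w X"
            using cut[of p q] cut[of q p] pq qp by auto
          with f show "f \<in> edges G1 \<union> edges G2" by (auto simp: G1_def G2_def)
        qed
      qed (auto simp: G1_def G2_def)
    qed
    interpret flip: gluing G2 G1 G w by (rule sym)
    have dA: "d \<notin> A" and eA: "e \<notin> A" using indep w d e by blast+
    \<comment> \<open>Each part retains an inner neighbour of \<open>w\<close>, as
      \<open>splits_unglue\<close> demands on either side.\<close>
    have "adj G1 w e" "adj G2 w d" using e d wV X eX by (auto simp: G1_def G2_def)
    then have s1: "splits G1 (A \<inter> verts G1)" and s2: "splits G2 (A \<inter> verts G2)"
      using splits_unglue[OF s w _ eA] flip.splits_unglue[OF s w _ dA] by auto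
    have "verts G1 \<subset> verts G" "verts G2 \<subset> verts G" using X wV eX by (auto simp: V12)
    then have c: "card (verts G1) < card (verts G)" "card (verts G2) < card (verts G)"
      using fin psubset_card_mono by blast+
    have "A \<inter> verts G1 \<noteq> {}" "A \<inter> verts G2 \<noteq> {}" using w w_in by auto
    moreover have "verts G1 - A \<inter> verts G1 \<noteq> {}" "verts G2 - A \<inter> verts G2 \<noteq> {}"
      using dA eA X eX wV by (auto simp: V12)
    ultimately obtain L1 L2 where L1: "T'_01_02 G1 L1" "outer G1 L1 = A \<inter> verts G1"
      and L2: "T'_01_02 G2 L2" "outer G2 L2 = A \<inter> verts G2"
      using less.hyps[OF c(1) t1 s1] less.hyps[OF c(2) t2 s2] by blast
    have Lw: "L1 w = StA" "L2 w = StA" using L1(2) L2(2) w w_in by (auto simp: outer_def)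
    define L where "L v = (if v \<in> verts G1 then L1 v else L2 v)" for v
    have L: "L v = L1 v" if "v \<in> verts G1" for v using that by (simp add: L_def)
    have L': "L v = L2 v" if "v \<in> verts G2" for v
    proof (cases "v = w")
      case True
      then show ?thesis using Lw by (simp add: L_def)
    next
      case False
      with that inter have "v \<notin> verts G1" by blast
      then show ?thesis by (simp add: L_def)
    qed
    have "identify_at_A G1 L1 G2 L2 G L"
      using inter Lw verts edges L L' by (rule identify_at_A_I)
    then have "T'_01_02 G L" using T'_glue L1 L2 by blast
    moreover have "outer G L = outer G1 L1 \<union> outer G2 L2"
      using L L' by (auto simp: outer_def verts)
    then have "outer G L = A" using L1(2) L2(2) A verts by blast
    ultimately show ?thesis by blast
  next
    case False
    interpret pendant_split G A
    proof
      fix a assume a: "a \<in> A"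
      \<comment> \<open>A minimum function with 0 at \<open>a\<close> provides a neighbour, and the
        case assumption rules out a second one.\<close>
      obtain f where f: "gamma_R_function G f" "f a = 0" using splits_outer_ex[OF s a] by blast
      obtain d where d: "adj G a d"
        using RDF_dominated[OF gamma_R_function_RDF[OF f(1)] _ f(2)] a A by blast
      then have "nbhd G a = {d}" using False a by (auto simp: nbhd_def)
      moreover have "d \<in> verts G - A" using d indep a simple_graph_adjD[OF sim d] by blast
      ultimately show "\<exists>d\<in>verts G - A. nbhd G a = {d}" by blast
    qed (use t s in auto)
    show ?thesis by (rule labeling[OF less.prems(4)])
  qed
qed

theorem theorem6p5:
  fixes T :: "'a graph"
  assumes "tree T"
  shows "(R_01_02_graph T \<longleftrightarrow> (\<exists>S. T_01_02 T S)) \<and>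
         ((\<exists>S. T_01_02 T S) \<longleftrightarrow> (\<exists>L. T'_01_02 T L))"
proof -
  have "(\<exists>S. T_01_02 T S) \<longleftrightarrow> (\<exists>L. T'_01_02 T L)"
    using T_imp_T' T'_imp_T by blast
  moreover have "R_01_02_graph T \<longleftrightarrow> (\<exists>L. T'_01_02 T L)"
    unfolding R_01_02_graph_iff by (metis splits_imp_T'[OF assms] T'_splits)
  ultimately show ?thesis by blast
qed

end
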